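(* Let $G$ be a compact group and let $\pi$ be an irreducible unitary representation of $G$ on a (complex) Hilbert space $\mathcal{H}$. Let $\mathcal{B}(\mathcal{H})$ be the algebra of bounded operators on $\mathcal{H}$. If $\mathcal{A}\subseteq\mathcal{B}(\mathcal{H})$ is a $\pi$-inductive algebra, then $\mathcal{A}$ is self-adjoint.
   Context: Given a unitary representation $\pi$ of $G$ on $\mathcal{H}$ (continuous in the usual sense), a $\pi$-inductive algebra is a weakly closed (i.e. closed in the weak operator topology) abelian subalgebra $\mathcal{A}$ of $\mathcal{B}(\mathcal{H})$ that is normalized by $\pi(G)$, i.e. $\pi(g)\mathcal{A}\pi(g)^{-1}=\mathcal{A}$ for each $g\in G$. A subalgebra is a complex linear subspace closed under multiplication; it is not required to contain the identity operator. A subalgebra $\mathcal{A}$ of $\mathcal{B}(\mathcal{H})$ is self-adjoint if $T\in\mathcal{A}$ implies $T^*\in\mathcal{A}$, where $T^*$ is the Hilbert space adjoint. *)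

theory Defs
  imports "HOL-Analysis.Analysis" "HOL-Algebra.Group"
begin

section \<open>Complex Hilbert spaces\<close>

class complex_vector = real_vector +
  fixes scaleC :: "complex \<Rightarrow> 'a \<Rightarrow> 'a"  (infixr \<open>*\<^sub>C\<close> 75)
  assumes scaleC_add_right: "c *\<^sub>C (x + y) = c *\<^sub>C x + c *\<^sub>C y"
    and scaleC_add_left: "(c + d) *\<^sub>C x = c *\<^sub>C x + d *\<^sub>C x"
    and scaleC_scaleC: "c *\<^sub>C d *\<^sub>C x = (c * d) *\<^sub>C x"
    and scaleC_one: "1 *\<^sub>C x = x"
    and scaleR_scaleC: "scaleR r x = complex_of_real r *\<^sub>C x"

global_interpretation complex_vector:
  vector_space "scaleC :: complex \<Rightarrow> 'a \<Rightarrow> 'a::complex_vector"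
  defines csubspace = complex_vector.subspace
  by unfold_locales (simp_all add: scaleC_add_right scaleC_add_left scaleC_scaleC scaleC_one)

text \<open>The inner product is linear in the first argument. The underlying real inner product space,
  which carries the norm and the topology, is given by the real part; positivity and definiteness
  of \<open>cinner\<close> follow from this together with \<open>cinner_commute\<close>.\<close>

class complex_inner = complex_vector + real_inner +
  fixes cinner :: "'a \<Rightarrow> 'a \<Rightarrow> complex"
  assumes cinner_commute: "cinner x y = cnj (cinner y x)"
    and cinner_add_left: "cinner (x + y) z = cinner x z + cinner y z"
    and cinner_scaleC_left: "cinner (c *\<^sub>C x) y = c * cinner x y"
    and inner_eq_Re_cinner: "inner x y = Re (cinner x y)"

lemma cinner_self: "cinner x x = complex_of_real ((norm x)\<^sup>2)"
  by (metis cinner_commute Reals_cnj_iff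
      inner_eq_Re_cinner of_real_Re power2_norm_eq_inner)

class chilbert_space = complex_inner + complete_space

instantiation complex :: chilbert_space
begin

definition scaleC_complex :: "complex \<Rightarrow> complex \<Rightarrow> complex"
  where "scaleC_complex c x = c * x"

definition cinner_complex :: "complex \<Rightarrow> complex \<Rightarrow> complex"
  where "cinner_complex x y = x * cnj y"

instance
  by standard
    (simp_all add: scaleC_complex_def cinner_complex_def inner_complex_def algebra_simps
      scaleR_conv_of_real)

end

section \<open>Bounded operators\<close>

definition bounded_clinear :: "('a::chilbert_space \<Rightarrow> 'a) \<Rightarrow> bool"
  where "bounded_clinear T \<longleftrightarrow> bounded_linear T \<and> (\<forall>c x. T (c *\<^sub>C x) = c *\<^sub>C T x)"

text \<open>The weak operator topology on the bounded operators: the coarsest topology that makes all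
  maps \<open>T \<mapsto> cinner (T x) y\<close> continuous. The target \<open>'a \<times> 'a \<Rightarrow> complex\<close> of the pullback
  carries the product topology.\<close>

definition weak_operator_topology :: "('a::chilbert_space \<Rightarrow> 'a) topology"
  where "weak_operator_topology =
    pullback_topology (Collect bounded_clinear) (\<lambda>T (x, y). cinner (T x) y) euclidean"

text \<open>For bounded complex-linear \<open>T\<close>, existence is the Riesz representation theorem and uniqueness
  follows from definiteness.\<close>

definition cadjoint :: "('a::chilbert_space \<Rightarrow> 'a) \<Rightarrow> ('a \<Rightarrow> 'a)"
  where "cadjoint T = (THE S. \<forall>x y. cinner (T x) y = cinner x (S y))"

definition self_adjoint :: "('a::chilbert_space \<Rightarrow> 'a) set \<Rightarrow> bool"
  where "self_adjoint A \<longleftrightarrow> (\<forall>T\<in>A. cadjoint T \<in> A)"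

text \<open>Subalgebras of the bounded operators; the identity need not belong to them.\<close>

definition subalgebra :: "('a::chilbert_space \<Rightarrow> 'a) set \<Rightarrow> bool"
  where "subalgebra A \<longleftrightarrow>
    A \<subseteq> Collect bounded_clinear \<and>
    (\<lambda>x. 0) \<in> A \<and>
    (\<forall>S\<in>A. \<forall>T\<in>A. (\<lambda>x. S x + T x) \<in> A) \<and>
    (\<forall>c. \<forall>T\<in>A. (\<lambda>x. c *\<^sub>C T x) \<in> A) \<and>
    (\<forall>S\<in>A. \<forall>T\<in>A. S \<circ> T \<in> A)"

definition abelian :: "('a \<Rightarrow> 'a) set \<Rightarrow> bool"
  where "abelian A \<longleftrightarrow> (\<forall>S\<in>A. \<forall>T\<in>A. S \<circ> T = T \<circ> S)"

definition unitary :: "('a::chilbert_space \<Rightarrow> 'a) \<Rightarrow> bool"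
  where "unitary U \<longleftrightarrow>
    bounded_clinear U \<and> surj U \<and> (\<forall>x y. cinner (U x) (U y) = cinner x y)"

definition unitary_group :: "('a::chilbert_space \<Rightarrow> 'a) monoid"
  where "unitary_group = \<lparr>carrier = Collect unitary, monoid.mult = (\<circ>), one = id\<rparr>"

section \<open>Compact groups and their unitary representations\<close>

locale topological_group = group G for G (structure) +
  fixes X :: "'a topology"
  assumes topspace_eq: "topspace X = carrier G"
    and continuous_mult: "continuous_map (prod_topology X X) X (\<lambda>(g, h). g \<otimes> h)"
    and continuous_inv: "continuous_map X X (\<lambda>g. inv g)"

text \<open>The Hausdorff property is not required, so that the compact Hausdorff groups form a special
  case.\<close>

locale compact_group = topological_group +
  assumes compact: "compact_space X"

text \<open>Representations are continuous with respect to the strong operator topology.\<close>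

definition unitary_rep ::
    "('g, 'b) monoid_scheme \<Rightarrow> 'g topology \<Rightarrow> ('g \<Rightarrow> 'h::chilbert_space \<Rightarrow> 'h) \<Rightarrow> bool"
  where "unitary_rep G X \<pi> \<longleftrightarrow>
    \<pi> \<in> hom G unitary_group \<and> (\<forall>v. continuous_map X euclidean (\<lambda>g. \<pi> g v))"

definition irreducible_rep ::
    "('g, 'b) monoid_scheme \<Rightarrow> ('g \<Rightarrow> 'h::chilbert_space \<Rightarrow> 'h) \<Rightarrow> bool"
  where "irreducible_rep G \<pi> \<longleftrightarrow>
    (UNIV :: 'h set) \<noteq> {0} \<and>
    (\<forall>S. csubspace S \<and> closed S \<and> (\<forall>g\<in>carrier G. \<pi> g ` S \<subseteq> S) \<longrightarrow> S = {0} \<or> S = UNIV)"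

definition inductive_algebra ::
    "('g, 'b) monoid_scheme \<Rightarrow> ('g \<Rightarrow> 'h::chilbert_space \<Rightarrow> 'h) \<Rightarrow> ('h \<Rightarrow> 'h) set \<Rightarrow> bool"
  where "inductive_algebra G \<pi> A \<longleftrightarrow>
    subalgebra A \<and> abelian A \<and> closedin weak_operator_topology A \<and>
    (\<forall>g\<in>carrier G. (\<lambda>T. \<pi> g \<circ> T \<circ> inv_into UNIV (\<pi> g)) ` A = A)"

end

theory Submission
  imports Defs "HOL-Computational_Algebra.Fundamental_Theorem_Algebra"
begin

text \<open>The proof has two parts.

  First, the representation is finite-dimensional, in the form that the unit ball is compact
  (\<open>compact_unit_ball\<close>). The usual argument averages the projection onto a vector over Haar measure.
  Here the average is replaced by a fixed point. The projections onto the vectors of an orbit form a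
  norm-compact set of operators because the group is compact. By Mazur's theorem its closed convex
  hull is compact as well (\<open>compact_closure_convex_hull\<close>), and the group acts on it by linear
  isometries, so there is a fixed point by Kakutani's theorem
  (\<open>linear_isometries_common_fixed_point\<close>). It is a nonzero compact symmetric operator that commutes
  with the group, and by Schur's lemma its square is a multiple of the identity.

  Second, let \<open>A\<close> be the algebra. For a function \<open>\<mu>\<close> on \<open>A\<close>, the weight space of \<open>\<mu>\<close> consists of
  the vectors \<open>v\<close> with \<open>T v = \<mu> T *\<^sub>C v\<close> for all \<open>T\<close> in \<open>A\<close>. Because conjugation by the group
  preserves \<open>A\<close>, the group permutes the weight spaces. As \<open>A\<close> is abelian, there is a common
  eigenvector, so by irreducibility the weight spaces span. They form a direct decomposition, with
  projections \<open>P W\<close> onto the weight spaces \<open>W\<close>. The group permutes these, so the Hermitian form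
  \<open>(x, y) \<mapsto> (\<Sum>W. cinner (P W x) (P W y))\<close> is invariant, and by Schur's lemma it is a multiple of
  the inner product. Different weight spaces are orthogonal for this form by construction; hence they
  are orthogonal for the inner product
  (\<open>permuted_direct_summands_orthogonal\<close>, \<open>weight_spaces_orthogonal\<close>). So every \<open>T\<close> in \<open>A\<close> is
  diagonal in an orthogonal decomposition, and its adjoint is the value at \<open>T\<close> of any polynomial
  that sends each eigenvalue to its complex conjugate. One can choose it with constant coefficient
  \<open>0\<close>, and then the adjoint belongs to \<open>A\<close> (\<open>adjoint_in_A\<close>).

  Schur's lemma is used for invariant Hermitian forms that attain their maximum on the unit sphere
  (\<open>invariant_form_eq_multiple_of_cinner\<close>), so that no spectral theorem is involved.\<close>

section \<open>Complex inner products\<close>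

lemma cinner_add_right: "cinner x (y + z) = cinner x y + cinner x z"
  for x :: "'h::complex_inner"
  by (metis cinner_commute cinner_add_left complex_cnj_add)

lemma cinner_scaleC_right: "cinner x (c *\<^sub>C y) = cnj c * cinner x y"
  for x :: "'h::complex_inner"
  by (metis cinner_commute cinner_scaleC_left complex_cnj_mult)

lemma scaleC_zero_left [simp]: "0 *\<^sub>C x = 0"
  by (rule complex_vector.scale_zero_left)

lemma scaleC_zero_right [simp]: "c *\<^sub>C 0 = 0"
  by (rule complex_vector.scale_zero_right)

lemma cinner_zero_left [simp]: "cinner 0 y = 0" for y :: "'h::complex_inner"
  using cinner_scaleC_left[of 0 0 y] by simp

lemma cinner_zero_right [simp]: "cinner x 0 = 0" for x :: "'h::complex_inner"
  using cinner_scaleC_right[of x 0 0] by simp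

lemma cinner_diff_left: "cinner (x - y) z = cinner x z - cinner y z"
  for x :: "'h::complex_inner"
  using cinner_add_left[of "x - y" y z] by simp

lemma cinner_diff_right: "cinner z (x - y) = cinner z x - cinner z y"
  for x :: "'h::complex_inner"
  using cinner_add_right[of z "x - y" y] by simp

lemma cinner_ext:
  fixes x y :: "'h::complex_inner"
  assumes "\<And>z. cinner x z = cinner y z"
  shows "x = y"
proof -
  have "cinner (x - y) (x - y) = 0" using assms by (simp add: cinner_diff_left)
  then show ?thesis by (simp add: cinner_self)
qed

lemma cadjoint_eqI:
  fixes S T :: "'h::chilbert_space \<Rightarrow> 'h"
  assumes "\<And>x y. cinner (T x) y = cinner x (S y)"
  shows "cadjoint T = S"
  unfolding cadjoint_def
proof (rule the_equality)
  fix S' assume S': "\<forall>x y. cinner (T x) y = cinner x (S' y)"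
  show "S' = S"
  proof
    fix y
    have "cinner (S' y) z = cinner (S y) z" for z
      using S' assms cinner_commute by metis
    then show "S' y = S y" by (rule cinner_ext)
  qed
qed (use assms in auto)

lemma norm_scaleC: "norm (c *\<^sub>C x) = cmod c * norm x" for x :: "'h::complex_inner"
proof -
  have "complex_of_real ((norm (c *\<^sub>C x))\<^sup>2) = c * cnj c * complex_of_real ((norm x)\<^sup>2)"
    unfolding cinner_self[symmetric] by (simp add: cinner_scaleC_left cinner_scaleC_right)
  also have "\<dots> = complex_of_real ((cmod c * norm x)\<^sup>2)"
    by (simp add: complex_norm_square[symmetric] power_mult_distrib)
  finally have "(norm (c *\<^sub>C x))\<^sup>2 = (cmod c * norm x)\<^sup>2"
    using of_real_eq_iff by blast
  then show ?thesis by simp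
qed

text \<open>Rotating \<open>x\<close> by a phase makes the inner product real, so that the inequality of the
  underlying real inner product space applies.\<close>

lemma norm_cinner_le: "cmod (cinner x y) \<le> norm x * norm y" for x :: "'h::complex_inner"
proof (cases "cinner x y = 0")
  case False
  define u where "u = cnj (sgn (cinner x y))"
  have u: "cmod u = 1" using False by (simp add: u_def norm_sgn)
  have "cinner (u *\<^sub>C x) y = complex_of_real (cmod (cinner x y))"
    unfolding u_def cinner_scaleC_left sgn_eq
    using False by (simp add: divide_simps complex_norm_square[symmetric] power2_eq_square mult.commute)
  then have "cmod (cinner x y) = inner (u *\<^sub>C x) y"
    by (simp add: inner_eq_Re_cinner)
  also have "\<dots> \<le> norm (u *\<^sub>C x) * norm y" by (rule norm_cauchy_schwarz)
  finally show ?thesis by (simp add: norm_scaleC u)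
qed simp

lemma bounded_bilinear_cinner:
  "bounded_bilinear (cinner :: 'h::complex_inner \<Rightarrow> 'h \<Rightarrow> complex)"
proof
  show "\<exists>K. \<forall>a b :: 'h. norm (cinner a b) \<le> norm a * norm b * K"
    by (intro exI[of _ 1]) (simp add: norm_cinner_le)
qed (simp_all add: cinner_add_left cinner_add_right scaleR_scaleC[where 'a = 'h]
      cinner_scaleC_left cinner_scaleC_right scaleR_conv_of_real)

lemma bounded_bilinear_scaleC:
  "bounded_bilinear (scaleC :: complex \<Rightarrow> 'h::complex_inner \<Rightarrow> 'h)"
proof
  show "\<exists>K. \<forall>a. \<forall>b :: 'h. norm (a *\<^sub>C b) \<le> norm a * norm b * K"
    by (intro exI[of _ 1]) (simp add: norm_scaleC)
qed (simp_all add: scaleC_add_left scaleC_add_right scaleR_scaleC[where 'a = 'h] scaleC_scaleC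
      scaleR_conv_of_real mult.commute)

lemmas continuous_on_cinner [continuous_intros] =
  bounded_bilinear.continuous_on[OF bounded_bilinear_cinner]

lemmas continuous_on_scaleC [continuous_intros] =
  bounded_bilinear.continuous_on[OF bounded_bilinear_scaleC]

lemma csubspaceI:
  assumes "0 \<in> S" "\<And>x y. x \<in> S \<Longrightarrow> y \<in> S \<Longrightarrow> x + y \<in> S" "\<And>c x. x \<in> S \<Longrightarrow> c *\<^sub>C x \<in> S"
  shows "csubspace S"
  by (rule complex_vector.subspaceI) (use assms in auto)

section \<open>Invariant forms\<close>

text \<open>If \<open>p x y\<close> were not \<open>0\<close>, then a small move of \<open>x\<close> along a multiple of \<open>y\<close> would make the
  form negative.\<close>

lemma psd_form_null:
  fixes p :: "'h::complex_vector \<Rightarrow> 'h \<Rightarrow> complex"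
  assumes add: "\<And>x y z. p (x + y) z = p x z + p y z"
    and scale: "\<And>c x y. p (c *\<^sub>C x) y = c * p x y"
    and herm: "\<And>x y. p x y = cnj (p y x)"
    and pos: "\<And>x. Re (p x x) \<ge> 0"
    and null: "Re (p x x) = 0"
  shows "p x y = 0"
proof -
  have add_r: "p z (x + y) = p z x + p z y" for x y z
    by (metis add herm complex_cnj_add)
  have scale_r: "p x (c *\<^sub>C y) = cnj c * p x y" for c x y
    by (metis scale herm complex_cnj_mult)
  define w where "w = p x y"
  define d where "d = Re (p y y)"
  have d: "d \<ge> 0" using pos by (simp add: d_def)
  define t where "t = - 1 / (d + 1)"
  (* Moving x by t w y with t real changes the form by t |w|^2 (2 + t d), which is
     negative for this t unless w = 0. *)
  define s where "s = complex_of_real t * w"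
  have yy: "p y y = complex_of_real d"
    using herm[of y y] by (simp add: d_def complex_eq_iff)
  have yx: "p y x = cnj w" unfolding w_def by (rule herm)
  have "p (x + s *\<^sub>C y) (x + s *\<^sub>C y) = p x x + cnj s * w + s * cnj w + s * cnj s * d"
    by (simp add: add add_r scale scale_r yy yx w_def[symmetric] algebra_simps)
  also have "Re \<dots> = 2 * t * (cmod w)\<^sup>2 + t\<^sup>2 * (cmod w)\<^sup>2 * d"
    by (simp add: null s_def cmod_power2) (simp add: power2_eq_square algebra_simps)
  also have "\<dots> = t * (cmod w)\<^sup>2 * (2 + t * d)" by (simp add: power2_eq_square algebra_simps)
  finally have ge: "t * (cmod w)\<^sup>2 * (2 + t * d) \<ge> 0" using pos by metis
  have "2 + t * d > 0" "t < 0" using d by (auto simp: t_def field_simps)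
  then have "t * (2 + t * d) < 0" by (simp add: mult_neg_pos)
  moreover have "(t * (2 + t * d)) * (cmod w)\<^sup>2 \<ge> 0" using ge by (simp add: mult_ac)
  ultimately have "(cmod w)\<^sup>2 \<le> 0" by (metis mult_neg_pos not_le)
  then show ?thesis by (simp add: w_def)
qed

text \<open>A form of Schur's lemma. The maximum \<open>c\<close> of the form on the unit sphere plays the part of
  an eigenvalue, and the vectors at which it is attained form the eigenspace, which is a closed
  invariant subspace.\<close>

lemma invariant_form_eq_multiple_of_cinner:
  fixes b :: "'h::chilbert_space \<Rightarrow> 'h \<Rightarrow> complex" and c :: real
  assumes irr: "irreducible_rep G \<pi>"
    and unit: "\<And>g x y. g \<in> carrier G \<Longrightarrow> cinner (\<pi> g x) (\<pi> g y) = cinner x y"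
    and surj: "\<And>g. g \<in> carrier G \<Longrightarrow> surj (\<pi> g)"
    and add: "\<And>x y z. b (x + y) z = b x z + b y z"
    and scale: "\<And>c x y. b (c *\<^sub>C x) y = c * b x y"
    and herm: "\<And>x y. b x y = cnj (b y x)"
    and cont: "\<And>y. continuous_on UNIV (\<lambda>x. b x y)"
    and inv: "\<And>g x y. g \<in> carrier G \<Longrightarrow> b (\<pi> g x) (\<pi> g y) = b x y"
    and bound: "\<And>x. Re (b x x) \<le> c * (norm x)\<^sup>2"
    and max: "v \<noteq> 0" "Re (b v v) = c * (norm v)\<^sup>2"
  shows "b x y = complex_of_real c * cinner x y"
proof -
  define S where "S = {x. \<forall>y. b x y = complex_of_real c * cinner x y}"
  have "complex_of_real c * cinner v y - b v y = 0" for y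
  proof (rule psd_form_null[where p = "\<lambda>x y. complex_of_real c * cinner x y - b x y"])
    show "complex_of_real c * cinner x y - b x y = cnj (complex_of_real c * cinner y x - b y x)"
      for x y
      using herm[of x y] cinner_commute[of x y] by simp
  qed (use bound max(2) in \<open>simp_all add: add scale cinner_add_left cinner_scaleC_left cinner_self algebra_simps\<close>)
  then have "v \<in> S" by (simp add: S_def)
  have "csubspace S"
    using scale[of 0] by (intro csubspaceI) (auto simp: S_def add scale cinner_add_left cinner_scaleC_left algebra_simps)
  moreover have "closed S"
  proof -
    have "S = (\<Inter>y. {x. b x y = complex_of_real c * cinner x y})" by (auto simp: S_def)
    moreover have "closed {x. b x y = complex_of_real c * cinner x y}" for y
      by (intro closed_Collect_eq cont continuous_intros)
    ultimately show ?thesis by auto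
  qed
  moreover have "\<pi> g ` S \<subseteq> S" if g: "g \<in> carrier G" for g
  proof clarify
    fix x assume x: "x \<in> S"
    have "b (\<pi> g x) y = complex_of_real c * cinner (\<pi> g x) y" for y
    proof -
      obtain z where "y = \<pi> g z" using surj[OF g] by (metis surjD)
      then show ?thesis using x by (simp add: S_def inv[OF g] unit[OF g])
    qed
    then show "\<pi> g x \<in> S" by (simp add: S_def)
  qed
  ultimately have "S = {0} \<or> S = UNIV" using irr by (simp add: irreducible_rep_def)
  then have "S = UNIV" using \<open>v \<in> S\<close> max(1) by auto
  then show ?thesis by (auto simp: S_def)
qed

section \<open>Fixed points in compact convex sets\<close>

text \<open>Mazur's theorem: a finite net of \<open>S\<close> spans a polytope, which is compact, and the convex
  hull of \<open>S\<close> stays as close to the polytope as \<open>S\<close> is to the net.\<close>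

lemma compact_closure_convex_hull:
  fixes S :: "'a::banach set"
  assumes "compact S"
  shows "compact (closure (convex hull S))"
  unfolding compact_eq_totally_bounded
proof (intro conjI allI impI)
  show "complete (closure (convex hull S))"
    by (simp add: complete_eq_closed)
  fix e :: real assume e: "e > 0"
  then have "e / 4 > 0" by simp
  then obtain F where F: "finite F" "S \<subseteq> (\<Union>x\<in>F. ball x (e/4))"
    using assms unfolding compact_eq_totally_bounded by blast
  have "compact (convex hull F)" using F(1) by (rule finite_imp_compact_convex_hull)
  then obtain N where N: "finite N" "convex hull F \<subseteq> (\<Union>x\<in>N. ball x (e/4))"
    using \<open>e / 4 > 0\<close> unfolding compact_eq_totally_bounded by blast
  define D where "D = (\<Union>u\<in>convex hull F. \<Union>w\<in>ball 0 (e/4). {u + w})"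
  have "convex D" unfolding D_def by (intro convex_sums convex_convex_hull convex_ball)
  moreover have "S \<subseteq> D"
  proof
    fix s assume "s \<in> S"
    then obtain x where x: "x \<in> F" "s \<in> ball x (e/4)" using F(2) by blast
    then have "x \<in> convex hull F" "s - x \<in> ball 0 (e/4)" "s = x + (s - x)"
      by (auto simp: hull_inc dist_norm norm_minus_commute)
    then show "s \<in> D" unfolding D_def by blast
  qed
  ultimately have hull: "convex hull S \<subseteq> D" by (simp add: hull_minimal)
  have "closure (convex hull S) \<subseteq> (\<Union>x\<in>N. ball x e)"
  proof
    fix y assume "y \<in> closure (convex hull S)"
    then obtain z where z: "z \<in> convex hull S" "dist z y < e/4"
      using \<open>e / 4 > 0\<close> unfolding closure_approachable by blast
    then obtain u w where u: "u \<in> convex hull F" "norm w < e/4" "z = u + w"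
      using hull unfolding D_def by (auto simp: dist_norm)
    then obtain x where x: "x \<in> N" "dist x u < e/4" using N(2) by fastforce
    have "dist u z < e/4" using u by (simp add: dist_norm)
    then have "dist x y < e"
      using x(2) z(2) e dist_triangle[of x y u] dist_triangle[of u y z] by linarith
    then show "y \<in> (\<Union>x\<in>N. ball x e)" using x(1) by auto
  qed
  then show "\<exists>k. finite k \<and> closure (convex hull S) \<subseteq> (\<Union>x\<in>k. ball x e)"
    using N(1) by blast
qed

lemma compact_chain_Inter_nonempty:
  fixes \<D> :: "'a::t2_space set set"
  assumes ne: "\<D> \<noteq> {}" and chain: "subset.chain UNIV \<D>"
    and comp: "\<And>L. L \<in> \<D> \<Longrightarrow> compact L \<and> L \<noteq> {}"
  shows "\<Inter>\<D> \<noteq> {}"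
proof -
  obtain L0 where L0: "L0 \<in> \<D>" using ne by blast
  have fin: "\<Inter>\<F> \<in> \<F>" if "finite \<F>" "\<F> \<noteq> {}" "\<F> \<subseteq> \<D>" for \<F>
    using that
  proof (induction \<F> rule: finite_ne_induct)
    case (insert L \<F>)
    then have "\<Inter>\<F> \<in> \<F>" by simp
    then have "L \<subseteq> \<Inter>\<F> \<or> \<Inter>\<F> \<subseteq> L"
      using insert.prems chain unfolding subset_chain_def by (meson insert_subset subsetD)
    then show ?case using \<open>\<Inter>\<F> \<in> \<F>\<close> by (auto simp: Int_absorb1 Int_absorb2)
  qed simp
  have "L0 \<inter> \<Inter>\<D> \<noteq> {}"
  proof (rule compact_imp_fip)
    fix \<F> assume "finite \<F>" "\<F> \<subseteq> \<D>"
    then have "\<Inter>(insert L0 \<F>) \<in> insert L0 \<F>" "insert L0 \<F> \<subseteq> \<D>" using fin[of "insert L0 \<F>"] L0 by auto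
    then have "\<Inter>(insert L0 \<F>) \<noteq> {}" using comp by (metis subsetD)
    then show "L0 \<inter> \<Inter>\<F> \<noteq> {}" by simp
  qed (use comp L0 in \<open>auto simp: compact_imp_closed\<close>)
  then show ?thesis by blast
qed

text \<open>A compact convex set \<open>L\<close> with more than one point has a centre \<open>m\<close> whose distance to every
  point of \<open>L\<close> is bounded by a constant below the diameter, so that the points with this property
  form a smaller convex set. The centre is the mean of a finite net.\<close>

lemma compact_convex_nondiametral_point:
  fixes L :: "'a::real_normed_vector set"
  assumes L: "compact L" "convex L" and xy: "x \<in> L" "y \<in> L" "x \<noteq> y"
  obtains m r a b where "m \<in> L" "\<And>z. z \<in> L \<Longrightarrow> dist m z \<le> r" "a \<in> L" "b \<in> L" "r < dist a b"
proof -
  have "continuous_on (L \<times> L) (\<lambda>p. dist (fst p) (snd p))" by (intro continuous_intros)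
  moreover have "compact (L \<times> L)" "L \<times> L \<noteq> {}" using L xy by (auto intro: compact_Times)
  ultimately obtain p where p: "p \<in> L \<times> L" "\<And>q. q \<in> L \<times> L \<Longrightarrow> dist (fst q) (snd q) \<le> dist (fst p) (snd p)"
    using continuous_attains_sup[of "L \<times> L" "\<lambda>p. dist (fst p) (snd p)"] by blast
  define d where "d = dist (fst p) (snd p)"
  have d: "dist u w \<le> d" if "u \<in> L" "w \<in> L" for u w using p(2)[of "(u, w)"] that by (simp add: d_def)
  have "d > 0" using d[OF xy(1,2)] xy(3) by (metis dist_nz order_less_le_trans)
  obtain F where F: "F \<subseteq> L" "finite F" "L \<subseteq> (\<Union>x\<in>F. ball x (d/2))"
  proof (rule compactE_image[OF L(1), of L "\<lambda>x. ball x (d/2)"])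
    show "L \<subseteq> (\<Union>x\<in>L. ball x (d/2))" using \<open>d > 0\<close> by fastforce
  qed auto
  have "F \<noteq> {}" using F(3) xy by auto
  define n where "n = real (card F)"
  have n: "n > 0" using \<open>F \<noteq> {}\<close> F(2) by (simp add: n_def card_gt_0_iff)
  define m where "m = (\<Sum>u\<in>F. (1/n) *\<^sub>R u)"
  have "m \<in> L" unfolding m_def
    by (rule convex_sum) (use F L n in \<open>auto simp: n_def\<close>)
  moreover have "dist m z \<le> d - d / (2 * n)" if z: "z \<in> L" for z
  proof -
    obtain v where v: "v \<in> F" "dist v z < d/2" using F(3) z by auto
    have "m - z = (\<Sum>u\<in>F. (1/n) *\<^sub>R (u - z))"
      using n by (simp add: m_def scaleR_diff_right sum_subtractf sum_constant_scaleR n_def)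
    then have "dist m z = norm (\<Sum>u\<in>F. (1/n) *\<^sub>R (u - z))" by (simp only: dist_norm)
    also have "\<dots> \<le> (\<Sum>u\<in>F. norm ((1/n) *\<^sub>R (u - z)))" by (rule norm_sum)
    also have "\<dots> = (\<Sum>u\<in>F. dist u z / n)" using n by (simp add: dist_norm)
    also have "\<dots> = dist v z / n + (\<Sum>u\<in>F - {v}. dist u z / n)"
      using F(2) v(1) by (simp add: sum.remove)
    also have "\<dots> \<le> (d/2) / n + (\<Sum>u\<in>F - {v}. d / n)"
      using F(1) z n v(2) by (intro add_mono sum_mono divide_right_mono d) auto
    also have "(\<Sum>u\<in>F - {v}. d / n) = (n - 1) * (d / n)"
      using F(2) v(1) n by (simp add: n_def of_nat_diff Suc_leI card_gt_0_iff)
    also have "(d/2) / n + (n - 1) * (d / n) = d - d / (2 * n)"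
      using n by (simp add: field_simps)
    finally show ?thesis .
  qed
  moreover have "d - d / (2 * n) < dist (fst p) (snd p)" using \<open>d > 0\<close> n by (simp add: d_def[symmetric])
  moreover have "fst p \<in> L" "snd p \<in> L" using p(1) by auto
  ultimately show thesis by (intro that)
qed

text \<open>Kakutani's fixed point theorem for groups of linear isometries: a minimal invariant compact
  convex set is a point, as otherwise its central part would be smaller.\<close>

lemma linear_isometries_common_fixed_point:
  fixes K :: "'a::real_normed_vector set" and \<Phi> :: "('a \<Rightarrow> 'a) set"
  assumes K: "compact K" "convex K" "K \<noteq> {}"
    and maps: "\<And>\<phi>. \<phi> \<in> \<Phi> \<Longrightarrow> \<phi> ` K \<subseteq> K"
    and lin: "\<And>\<phi>. \<phi> \<in> \<Phi> \<Longrightarrow> linear \<phi>"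
    and iso: "\<And>\<phi> x. \<phi> \<in> \<Phi> \<Longrightarrow> norm (\<phi> x) = norm x"
    and inv: "\<And>\<phi>. \<phi> \<in> \<Phi> \<Longrightarrow> \<exists>\<psi>\<in>\<Phi>. \<forall>x. \<phi> (\<psi> x) = x"
  obtains x where "x \<in> K" "\<And>\<phi>. \<phi> \<in> \<Phi> \<Longrightarrow> \<phi> x = x"
proof -
  define \<S> where "\<S> = {L. L \<subseteq> K \<and> compact L \<and> convex L \<and> L \<noteq> {} \<and> (\<forall>\<phi>\<in>\<Phi>. \<phi> ` L \<subseteq> L)}"
  (* Zorn's lemma yields maximal sets, so it is applied to the complements. *)
  have "\<exists>M\<in>uminus ` \<S>. \<forall>X\<in>uminus ` \<S>. M \<subseteq> X \<longrightarrow> X = M"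
  proof (rule subset_Zorn_nonempty)
    have "K \<in> \<S>" using K maps by (simp add: \<S>_def)
    then show "uminus ` \<S> \<noteq> {}" by blast
    fix \<C> assume ne: "\<C> \<noteq> {}" and chain: "subset.chain (uminus ` \<S>) \<C>"
    define \<D> where "\<D> = uminus ` \<C>"
    have sub: "\<D> \<subseteq> \<S>" using chain unfolding \<D>_def subset_chain_def by auto
    have "subset.chain UNIV \<D>" using chain unfolding \<D>_def subset_chain_def by auto
    then have "\<Inter>\<D> \<noteq> {}"
      using sub ne by (intro compact_chain_Inter_nonempty) (auto simp: \<S>_def \<D>_def)
    moreover obtain L0 where "L0 \<in> \<D>" using ne by (auto simp: \<D>_def)
    moreover have "compact (\<Inter>\<D>)"
    proof -
      have "closed (\<Inter>\<D>)" using sub by (intro closed_Inter) (auto simp: \<S>_def compact_imp_closed)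
      then have "compact (L0 \<inter> \<Inter>\<D>)"
        using sub \<open>L0 \<in> \<D>\<close> by (intro compact_Int_closed) (auto simp: \<S>_def)
      then show ?thesis using \<open>L0 \<in> \<D>\<close> by (simp add: Inf_lower inf.absorb2)
    qed
    moreover have "convex (\<Inter>\<D>)" using sub by (intro convex_Inter) (auto simp: \<S>_def)
    moreover have "\<phi> ` \<Inter>\<D> \<subseteq> \<Inter>\<D>" if "\<phi> \<in> \<Phi>" for \<phi> using sub that by (fastforce simp: \<S>_def)
    ultimately have "\<Inter>\<D> \<in> \<S>" using sub unfolding \<S>_def by blast
    moreover have "\<Union>\<C> = - \<Inter>\<D>" by (simp add: \<D>_def)
    ultimately show "\<Union>\<C> \<in> uminus ` \<S>" by blast
  qed
  then obtain L where L: "L \<in> \<S>" and min: "\<And>M. M \<in> \<S> \<Longrightarrow> M \<subseteq> L \<Longrightarrow> M = L" by auto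
  then obtain x where x: "x \<in> L" by (auto simp: \<S>_def)
  have "y = x" if y: "y \<in> L" for y
  proof (rule ccontr)
    assume "y \<noteq> x"
    obtain m r a b where m: "m \<in> L" "\<And>z. z \<in> L \<Longrightarrow> dist m z \<le> r"
      and ab: "a \<in> L" "b \<in> L" "r < dist a b"
    proof (rule compact_convex_nondiametral_point)
      show "compact L" "convex L" using L by (auto simp: \<S>_def)
    qed (use y x \<open>y \<noteq> x\<close> in auto)
    define M where "M = L \<inter> (\<Inter>z\<in>L. cball z r)"
    have "compact M" unfolding M_def using L by (intro compact_Int_closed) (auto simp: \<S>_def)
    moreover have "convex M" unfolding M_def using L
      by (intro convex_Int convex_INT) (auto simp: \<S>_def)
    moreover have "m \<in> M" using m by (auto simp: M_def dist_commute)
    moreover have "\<phi> ` M \<subseteq> M" if \<phi>: "\<phi> \<in> \<Phi>" for \<phi>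
    proof clarify
      fix u assume u: "u \<in> M"
      have "dist z (\<phi> u) \<le> r" if "z \<in> L" for z
      proof -
        obtain \<psi> where \<psi>: "\<psi> \<in> \<Phi>" "\<And>x. \<phi> (\<psi> x) = x" using inv[OF \<phi>] by blast
        have "dist z (\<phi> u) = norm (\<phi> (\<psi> z - u))"
          by (simp add: dist_norm linear_diff[OF lin[OF \<phi>]] \<psi>(2))
        also have "\<dots> = dist (\<psi> z) u" by (simp add: iso[OF \<phi>] dist_norm)
        also have "\<psi> z \<in> L" using L \<psi>(1) that by (auto simp: \<S>_def)
        then have "dist (\<psi> z) u \<le> r" using u by (auto simp: M_def)
        finally show ?thesis .
      qed
      moreover have "\<phi> ` L \<subseteq> L" "u \<in> L" using L \<phi> u by (simp_all add: M_def \<S>_def)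
      ultimately show "\<phi> u \<in> M" by (auto simp: M_def)
    qed
    ultimately have "M \<in> \<S>" using L by (auto simp: \<S>_def M_def)
    then have "M = L" using min by (auto simp: M_def)
    then have "b \<in> (\<Inter>z\<in>L. cball z r)" using ab(2) unfolding M_def by blast
    then show False using ab(1,3) by auto
  qed
  moreover have "\<phi> x \<in> L" if "\<phi> \<in> \<Phi>" for \<phi> using L x that unfolding \<S>_def by blast
  ultimately have "\<phi> x = x" if "\<phi> \<in> \<Phi>" for \<phi> using that by simp
  moreover have "x \<in> K" using L x unfolding \<S>_def by blast
  ultimately show thesis by (intro that)
qed

section \<open>Inner product spaces with compact unit ball\<close>

lemma diff_projection_orthogonal:
  fixes C :: "'a::real_inner set"
  assumes C: "finite C" "pairwise orthogonal C" and s: "s \<in> span C"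
  shows "inner (x - (\<Sum>c\<in>C. (inner x c / inner c c) *\<^sub>R c)) s = 0"
  using s
proof (induction rule: span_induct_alt)
  case (step a c s)
  have "inner (\<Sum>d\<in>C. (inner x d / inner d d) *\<^sub>R d) c
      = (\<Sum>d\<in>C. if d = c then inner x c else 0)"
    unfolding inner_sum_left
  proof (rule sum.cong)
    fix d assume "d \<in> C"
    then show "inner ((inner x d / inner d d) *\<^sub>R d) c = (if d = c then inner x c else 0)"
      using C(2) step(1) by (auto simp: pairwise_def orthogonal_def)
  qed simp
  then show ?case using C(1) step by (simp add: inner_diff_left inner_add_right)
qed simp

text \<open>A unit vector orthogonal to a finite net of the unit ball has distance at least \<open>1\<close> from
  every point of the net.\<close>

lemma compact_cball_imp_finite_spanning_set:
  assumes "compact (cball 0 1 :: 'a::real_inner set)"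
  obtains F :: "'a::real_inner set" where "finite F" "span F = UNIV"
proof -
  obtain F :: "'a set" where F: "finite F" "cball 0 1 \<subseteq> (\<Union>x\<in>F. ball x 1)"
    using assms unfolding compact_eq_totally_bounded by (metis zero_less_one)
  obtain C where C: "finite C" "span C = span F" "pairwise orthogonal C"
    using basis_orthogonal[OF F(1)] by blast
  have "x \<in> span F" for x
  proof (rule ccontr)
    assume x: "x \<notin> span F"
    define p where "p = (\<Sum>c\<in>C. (inner x c / inner c c) *\<^sub>R c)"
    have "p \<in> span F" unfolding p_def C(2)[symmetric] by (intro span_sum span_scale span_base)
    then have "x - p \<noteq> 0" using x by auto
    define y where "y = (x - p) /\<^sub>R norm (x - p)"
    have y: "norm y = 1" using \<open>x - p \<noteq> 0\<close> by (simp add: y_def)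
    then have "y \<in> cball 0 1" by simp
    then obtain f where "f \<in> F" "y \<in> ball f 1" using F(2) by blast
    then have f: "f \<in> F" "dist f y < 1" by auto
    have "inner y f = 0"
      using diff_projection_orthogonal[OF C(1,3), of f x] f(1)
      by (simp add: y_def p_def C(2) span_base)
    moreover have "inner y y = 1" using y by (simp add: norm_eq_1)
    ultimately have "(dist f y)\<^sup>2 = inner f f + 1"
      by (simp add: dist_norm power2_norm_eq_inner inner_diff_left inner_diff_right inner_commute)
    moreover have "(dist f y)\<^sup>2 < 1\<^sup>2" using f(2) by (intro power_strict_mono) auto
    ultimately show False using inner_ge_zero[of f] by simp
  qed
  then show thesis using F(1) that by blast
qed

text \<open>If \<open>x\<close> lies in the closure, then so does \<open>x - p\<close>, where \<open>p\<close> is the projection of \<open>x\<close>. This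
  difference is orthogonal to the span, hence to its closure and to itself.\<close>

lemma closed_span_finite:
  fixes S :: "'a::real_inner set"
  assumes "finite S"
  shows "closed (span S)"
proof -
  obtain C where C: "finite C" "span C = span S" "pairwise orthogonal C"
    using basis_orthogonal[OF assms] by blast
  have "x \<in> span C" if x: "x \<in> closure (span C)" for x
  proof -
    define p where "p = (\<Sum>c\<in>C. (inner x c / inner c c) *\<^sub>R c)"
    have p: "p \<in> span C" unfolding p_def by (intro span_sum span_scale span_base)
    have orth: "inner (x - p) s = 0" if "s \<in> span C" for s
      unfolding p_def using C(1,3) that by (rule diff_projection_orthogonal)
    have "closure (span C) \<subseteq> {s. inner (x - p) s = 0}"
      by (intro closure_minimal closed_Collect_eq continuous_intros) (use orth in auto)
    then have "inner (x - p) x = 0" using x by auto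
    then have "inner (x - p) (x - p) = 0" using orth[OF p] by (simp add: inner_diff_right)
    then show ?thesis using p by simp
  qed
  then show ?thesis using C(2) by (metis closure_subset_eq subsetI)
qed

lemma closed_subspace_if_finite_spanning_set:
  fixes V :: "'a::real_inner set"
  assumes F: "finite F" "span F = (UNIV :: 'a set)" and V: "subspace V"
  shows "closed V"
proof -
  obtain B where B: "B \<subseteq> V" "independent B" "V \<subseteq> span B"
    using maximal_independent_subset by blast
  have "finite B" using independent_span_bound[OF F(1) B(2)] F(2) by simp
  moreover have "span B = V" using B V by (metis span_minimal subset_antisym)
  ultimately show ?thesis using closed_span_finite by metis
qed

text \<open>An orthogonal basis expresses \<open>f\<close> through finitely many inner products.\<close>

lemma linear_continuous_if_finite_spanning_set:
  fixes f :: "'a::real_inner \<Rightarrow> 'b::real_normed_vector"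
  assumes F: "finite F" "span F = (UNIV :: 'a set)" and f: "linear f"
  shows "continuous_on S f"
proof -
  obtain C where C: "finite C" "span C = span F" "pairwise orthogonal C"
    using basis_orthogonal[OF F(1)] by blast
  have "x = (\<Sum>c\<in>C. (inner x c / inner c c) *\<^sub>R c)" for x
    using diff_projection_orthogonal[OF C(1,3), of "x - (\<Sum>c\<in>C. (inner x c / inner c c) *\<^sub>R c)" x]
    by (simp add: C(2) F(2))
  then have "f = (\<lambda>x. \<Sum>c\<in>C. (inner x c / inner c c) *\<^sub>R f c)"
    by (metis (no_types, lifting) ext linear_scale[OF f] linear_sum[OF f] sum.cong)
  moreover have "continuous_on S (\<lambda>x. \<Sum>c\<in>C. (inner x c / inner c c) *\<^sub>R f c)"
    unfolding divide_inverse by (intro continuous_intros)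
  ultimately show ?thesis by (rule ssubst[where P = "continuous_on S"])
qed

section \<open>Irreducible representations of compact groups\<close>

instance chilbert_space \<subseteq> banach ..

text \<open>For a unit vector \<open>w\<close> this is the orthogonal projection onto the line of \<open>w\<close>.\<close>

definition rank_one :: "'h::complex_inner \<Rightarrow> 'h \<Rightarrow>\<^sub>L 'h"
  where "rank_one w = Blinfun (\<lambda>x. cinner x w *\<^sub>C w)"

lemma rank_one_apply [simp]: "blinfun_apply (rank_one w) x = cinner x w *\<^sub>C w"
proof -
  have "bounded_linear (\<lambda>x. cinner x w *\<^sub>C w)"
    using bounded_linear_compose[OF bounded_bilinear.bounded_linear_left[OF bounded_bilinear_scaleC]
        bounded_bilinear.bounded_linear_left[OF bounded_bilinear_cinner]] .
  then show ?thesis by (simp add: rank_one_def bounded_linear_Blinfun_apply)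
qed

lemma continuous_on_rank_one: "continuous_on UNIV (rank_one :: 'h::complex_inner \<Rightarrow> _)"
proof -
  have diff: "norm (rank_one w - rank_one u) \<le> norm (w - u) * (norm w + norm u)" for w u :: 'h
  proof (rule norm_blinfun_bound)
    fix x
    have "blinfun_apply (rank_one w - rank_one u) x
        = cinner x w *\<^sub>C (w - u) + cinner x (w - u) *\<^sub>C u"
      by (simp add: blinfun.diff_left cinner_diff_right complex_vector.scale_right_diff_distrib
          complex_vector.scale_left_diff_distrib)
    also have "norm \<dots> \<le> norm x * norm w * norm (w - u) + norm x * norm (w - u) * norm u"
      by (intro order_trans[OF norm_triangle_ineq] add_mono)
        (auto simp: norm_scaleC intro!: mult_right_mono norm_cinner_le)
    finally show "norm (blinfun_apply (rank_one w - rank_one u) x)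
        \<le> norm (w - u) * (norm w + norm u) * norm x"
      by (simp add: algebra_simps)
  qed simp
  have "(rank_one \<longlongrightarrow> rank_one u) (at u)" for u :: 'h
  proof (rule LIM_zero_cancel, rule Lim_null_comparison)
    show "\<forall>\<^sub>F w in at u. norm (rank_one w - rank_one u) \<le> norm (w - u) * (norm w + norm u)"
      using diff by simp
    have "((\<lambda>w. norm (w - u) * (norm w + norm u)) \<longlongrightarrow> norm (u - u) * (norm u + norm u)) (at u)"
      by (intro tendsto_intros)
    then show "((\<lambda>w. norm (w - u) * (norm w + norm u)) \<longlongrightarrow> 0) (at u)" by simp
  qed
  then show ?thesis by (simp add: continuous_on_def)
qed

locale compact_irreducible_rep = compact_group G X for G (structure) and X +
  fixes \<pi> :: "'a \<Rightarrow> 'h::chilbert_space \<Rightarrow> 'h"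
  assumes rep: "unitary_rep G X \<pi>" and irr: "irreducible_rep G \<pi>"
begin

lemma unitary_rep_op: "g \<in> carrier G \<Longrightarrow> unitary (\<pi> g)"
  using rep by (auto simp: unitary_rep_def hom_def unitary_group_def)

lemma rep_mult: "g \<in> carrier G \<Longrightarrow> h \<in> carrier G \<Longrightarrow> \<pi> (g \<otimes> h) x = \<pi> g (\<pi> h x)"
  using rep by (auto simp: unitary_rep_def hom_def unitary_group_def)

lemma cinner_rep: "g \<in> carrier G \<Longrightarrow> cinner (\<pi> g x) (\<pi> g y) = cinner x y"
  using unitary_rep_op by (auto simp: unitary_def)

lemma bounded_linear_rep: "g \<in> carrier G \<Longrightarrow> bounded_linear (\<pi> g)"
  using unitary_rep_op by (auto simp: unitary_def bounded_clinear_def)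

lemma rep_add: "g \<in> carrier G \<Longrightarrow> \<pi> g (x + y) = \<pi> g x + \<pi> g y"
  using bounded_linear_rep by (intro linear_add bounded_linear.linear)

lemma rep_scaleC: "g \<in> carrier G \<Longrightarrow> \<pi> g (c *\<^sub>C x) = c *\<^sub>C \<pi> g x"
  using unitary_rep_op by (auto simp: unitary_def bounded_clinear_def)

lemma norm_rep: "g \<in> carrier G \<Longrightarrow> norm (\<pi> g x) = norm x"
  using cinner_rep[of g x x] unfolding cinner_self of_real_eq_iff by simp

lemma rep_one: "\<pi> \<one> x = x"
proof -
  have "\<pi> \<one> (\<pi> \<one> x) = \<pi> \<one> x" using rep_mult[of \<one> \<one> x] by simp
  then have "\<pi> \<one> (\<pi> \<one> x - x) = 0"
    using linear_diff[OF bounded_linear.linear[OF bounded_linear_rep]] by simp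
  then have "norm (\<pi> \<one> x - x) = 0" using norm_rep[of \<one> "\<pi> \<one> x - x"] by simp
  then show ?thesis by simp
qed

lemma rep_inv_left: "g \<in> carrier G \<Longrightarrow> \<pi> (inv g) (\<pi> g x) = x"
  using rep_mult[of "inv g" g x] by (simp add: rep_one)

lemma rep_inv_right: "g \<in> carrier G \<Longrightarrow> \<pi> g (\<pi> (inv g) x) = x"
  using rep_mult[of g "inv g" x] by (simp add: rep_one)

lemma surj_rep: "g \<in> carrier G \<Longrightarrow> surj (\<pi> g)"
  by (metis rep_inv_right surjI)

lemma inv_into_rep: "g \<in> carrier G \<Longrightarrow> inv_into UNIV (\<pi> g) = \<pi> (inv g)"
  by (intro inv_unique_comp) (auto simp: rep_inv_left rep_inv_right)

lemma compact_orbit: "compact ((\<lambda>g. \<pi> g v) ` carrier G)"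
proof -
  have "compactin X (carrier G)" using compact by (simp add: compact_space_def topspace_eq)
  then have "compactin euclidean ((\<lambda>g. \<pi> g v) ` carrier G)"
    using rep by (intro image_compactin[where X = X]) (auto simp: unitary_rep_def)
  then show ?thesis by simp
qed

definition conj_rep :: "'a \<Rightarrow> ('h \<Rightarrow>\<^sub>L 'h) \<Rightarrow> ('h \<Rightarrow>\<^sub>L 'h)"
  where "conj_rep g T = Blinfun (\<pi> g) o\<^sub>L T o\<^sub>L Blinfun (\<pi> (inv g))"

lemma conj_rep_apply: "g \<in> carrier G \<Longrightarrow> conj_rep g T x = \<pi> g (T (\<pi> (inv g) x))"
  by (simp add: conj_rep_def bounded_linear_Blinfun_apply bounded_linear_rep)

lemma linear_conj_rep: "g \<in> carrier G \<Longrightarrow> linear (conj_rep g)"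
  by (rule linearI; rule blinfun_eqI)
    (simp_all add: conj_rep_apply blinfun.add_left blinfun.scaleR_left rep_add
      linear_scale[OF bounded_linear.linear[OF bounded_linear_rep]])

lemma conj_rep_inv: "g \<in> carrier G \<Longrightarrow> conj_rep g (conj_rep (inv g) T) = T"
  by (rule blinfun_eqI) (simp add: conj_rep_apply rep_inv_right)

lemma norm_conj_rep:
  assumes "g \<in> carrier G" shows "norm (conj_rep g T) = norm T"
proof -
  have le: "norm (conj_rep g T) \<le> norm T" if "g \<in> carrier G" for g T
    by (rule norm_blinfun_bound) (use that norm_blinfun[of T "\<pi> (inv g) _"] in \<open>simp_all add: conj_rep_apply norm_rep\<close>)
  show ?thesis
    using le[OF assms, of T] le[of "inv g" "conj_rep g T"] conj_rep_inv[of "inv g" T] assms by simp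
qed

lemma conj_rep_rank_one: "g \<in> carrier G \<Longrightarrow> conj_rep g (rank_one w) = rank_one (\<pi> g w)"
  using cinner_rep[of "inv g"]
  by (intro blinfun_eqI) (simp add: conj_rep_apply rep_scaleC, metis cinner_rep rep_inv_right)

text \<open>In place of the Haar average of the projections onto the orbit of a unit vector \<open>v\<close>, the
  fixed point theorem provides an invariant operator \<open>T\<close> in their closed convex hull, which is
  compact in the operator norm. The other properties of \<open>T\<close> are closed convex conditions that hold for
  each of these projections. For \<open>T \<noteq> 0\<close> the condition comes from a finite \<open>1\<close>-net \<open>N\<close> of the
  orbit: unit vectors \<open>u\<close>, \<open>w\<close> at distance less than \<open>1\<close> satisfy \<open>inner u w > 1/2\<close>, so
  the functional \<open>T \<mapsto> (\<Sum>w\<in>N. inner (T w) w)\<close> is at least \<open>1/4\<close> at each projection.\<close>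

lemma invariant_compact_operator:
  obtains T :: "'h \<Rightarrow>\<^sub>L 'h" and C where
    "T \<noteq> 0" "compact C" "\<And>x. norm x \<le> 1 \<Longrightarrow> T x \<in> C"
    "\<And>x y. cinner (T x) y = cinner x (T y)" "\<And>c x. T (c *\<^sub>C x) = c *\<^sub>C T x"
    "\<And>g x. g \<in> carrier G \<Longrightarrow> T (\<pi> g x) = \<pi> g (T x)"
proof -
  have "\<exists>u::'h. u \<noteq> 0" using irr by (auto simp: irreducible_rep_def)
  then obtain u :: 'h where "u \<noteq> 0" by blast
  define v where "v = u /\<^sub>R norm u"
  have v: "norm v = 1" using \<open>u \<noteq> 0\<close> by (simp add: v_def)
  define Orb where "Orb = (\<lambda>g. \<pi> g v) ` carrier G"
  have Orb: "compact Orb" "Orb \<noteq> {}" unfolding Orb_def by (auto intro: compact_orbit)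
  have norm_O: "norm w = 1" if "w \<in> Orb" for w using that v by (auto simp: Orb_def norm_rep)
  define K where "K = closure (convex hull (rank_one ` Orb))"
  have "compact (rank_one ` Orb)"
    using Orb(1) continuous_on_rank_one continuous_on_subset by (blast intro: compact_continuous_image)
  then have K: "compact K" unfolding K_def by (rule compact_closure_convex_hull)
  have K_inv: "conj_rep g ` K \<subseteq> K" if g: "g \<in> carrier G" for g
  proof -
    have "bounded_linear (conj_rep g)"
      by (rule bounded_linear_intro[where K = 1])
        (use linear_conj_rep[OF g] norm_conj_rep[OF g] in \<open>auto simp: linear_add linear_scale\<close>)
    then have "conj_rep g ` K \<subseteq> closure (conj_rep g ` (convex hull (rank_one ` Orb)))"
      unfolding K_def by (rule closure_bounded_linear_image_subset)
    also have "conj_rep g ` (convex hull (rank_one ` Orb)) = convex hull (conj_rep g ` rank_one ` Orb)"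
      using linear_conj_rep[OF g] by (rule convex_hull_linear_image)
    also have "conj_rep g ` rank_one ` Orb \<subseteq> rank_one ` Orb"
      using g by (auto simp: Orb_def conj_rep_rank_one rep_mult[symmetric])
    then have "closure (convex hull (conj_rep g ` rank_one ` Orb)) \<subseteq> K"
      unfolding K_def by (intro closure_mono hull_mono)
    finally show ?thesis .
  qed
  obtain T where T: "T \<in> K" "\<And>\<phi>. \<phi> \<in> conj_rep ` carrier G \<Longrightarrow> \<phi> T = T"
  proof (rule linear_isometries_common_fixed_point[of K "conj_rep ` carrier G"])
    show "compact K" "convex K" "K \<noteq> {}" using Orb(2) K by (auto simp: K_def)
    fix \<phi> assume "\<phi> \<in> conj_rep ` carrier G"
    then obtain g where g: "g \<in> carrier G" "\<phi> = conj_rep g" by blast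
    show "linear \<phi>" "norm (\<phi> x) = norm x" for x using g by (auto simp: linear_conj_rep norm_conj_rep)
    show "\<exists>\<psi>\<in>conj_rep ` carrier G. \<forall>x. \<phi> (\<psi> x) = x"
      using g conj_rep_inv by (intro bexI[of _ "conj_rep (inv g)"]) auto
    show "\<phi> ` K \<subseteq> K" using g K_inv by blast
  qed (use that in blast)
  have memI: "T \<in> D" if "\<And>w. w \<in> Orb \<Longrightarrow> rank_one w \<in> D" "convex D" "closed D" for D
  proof -
    have "K \<subseteq> D" unfolding K_def using that by (intro closure_minimal hull_minimal) auto
    then show ?thesis using T(1) by blast
  qed

  (* A projection rank_one w sends the unit ball to multiples s w with |s| at most 1. *)
  define S where "S = (\<lambda>(s, w). s *\<^sub>C w) ` (cball (0::complex) 1 \<times> Orb)"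
  define C where "C = closure (convex hull S)"
  have "compact S" unfolding S_def
    using Orb(1) by (intro compact_continuous_image compact_Times) (auto simp: case_prod_unfold intro!: continuous_intros)
  then have "compact C" unfolding C_def by (rule compact_closure_convex_hull)
  moreover have "T \<in> {T :: 'h \<Rightarrow>\<^sub>L 'h. \<forall>x. norm x \<le> 1 \<longrightarrow> T x \<in> C}"
  proof (rule memI)
    fix w assume w: "w \<in> Orb"
    have "cinner x w *\<^sub>C w \<in> C" if "norm x \<le> 1" for x
    proof -
      have "cinner x w \<in> cball 0 1" using norm_cinner_le[of x w] norm_O[OF w] that by simp
      then have "cinner x w *\<^sub>C w \<in> S" unfolding S_def using w by force
      then show ?thesis unfolding C_def by (meson closure_subset hull_inc subsetD)
    qed
    then show "rank_one w \<in> {T :: 'h \<Rightarrow>\<^sub>L 'h. \<forall>x. norm x \<le> 1 \<longrightarrow> T x \<in> C}" by simp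
  next
    have "convex C" by (simp add: C_def)
    then show "convex {T :: 'h \<Rightarrow>\<^sub>L 'h. \<forall>x. norm x \<le> 1 \<longrightarrow> T x \<in> C}"
      by (auto simp: convex_def blinfun.add_left blinfun.scaleR_left)
    have "closed ((\<lambda>T :: 'h \<Rightarrow>\<^sub>L 'h. T x) -` C)" for x
      using \<open>compact C\<close> by (intro closed_vimage compact_imp_closed continuous_intros)
    then have "closed {T :: 'h \<Rightarrow>\<^sub>L 'h. T x \<in> C}" for x by (simp add: vimage_def)
    then show "closed {T :: 'h \<Rightarrow>\<^sub>L 'h. \<forall>x. norm x \<le> 1 \<longrightarrow> T x \<in> C}"
      by (intro closed_Collect_all closed_Collect_imp) auto
  qed
  moreover have "T \<in> {T :: 'h \<Rightarrow>\<^sub>L 'h. \<forall>x y. cinner (T x) y = cinner x (T y)}"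
  proof (rule memI)
    show "rank_one w \<in> {T :: 'h \<Rightarrow>\<^sub>L 'h. \<forall>x y. cinner (T x) y = cinner x (T y)}" for w
      using cinner_commute[of w] by (auto simp: cinner_scaleC_left cinner_scaleC_right)
    show "convex {T :: 'h \<Rightarrow>\<^sub>L 'h. \<forall>x y. cinner (T x) y = cinner x (T y)}"
      by (auto simp: convex_def blinfun.add_left blinfun.scaleR_left cinner_add_left cinner_add_right
          scaleR_scaleC cinner_scaleC_left cinner_scaleC_right)
    show "closed {T :: 'h \<Rightarrow>\<^sub>L 'h. \<forall>x y. cinner (T x) y = cinner x (T y)}"
      by (intro closed_Collect_all closed_Collect_eq continuous_intros)
  qed
  moreover have "T \<in> {T :: 'h \<Rightarrow>\<^sub>L 'h. \<forall>c x. T (c *\<^sub>C x) = c *\<^sub>C T x}"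
  proof (rule memI)
    show "rank_one w \<in> {T :: 'h \<Rightarrow>\<^sub>L 'h. \<forall>c x. T (c *\<^sub>C x) = c *\<^sub>C T x}" for w
      by (auto simp: cinner_scaleC_left scaleC_scaleC)
    show "convex {T :: 'h \<Rightarrow>\<^sub>L 'h. \<forall>c x. T (c *\<^sub>C x) = c *\<^sub>C T x}"
      by (auto simp: convex_def blinfun.add_left blinfun.scaleR_left scaleC_add_right scaleR_scaleC
          scaleC_scaleC mult.commute)
    show "closed {T :: 'h \<Rightarrow>\<^sub>L 'h. \<forall>c x. T (c *\<^sub>C x) = c *\<^sub>C T x}"
      by (intro closed_Collect_all closed_Collect_eq continuous_intros)
  qed
  moreover have "T (\<pi> g x) = \<pi> g (T x)" if "g \<in> carrier G" for g x
  proof -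
    have "conj_rep g T (\<pi> g x) = T (\<pi> g x)" using T(2)[of "conj_rep g"] that by simp
    then show ?thesis using that by (simp add: conj_rep_apply rep_inv_left)
  qed
  moreover have "T \<noteq> 0"
  proof -
    obtain N where N: "N \<subseteq> Orb" "finite N" "Orb \<subseteq> (\<Union>w\<in>N. ball w 1)"
    proof (rule compactE_image[OF Orb(1), of Orb "\<lambda>w. ball w 1"])
      show "Orb \<subseteq> (\<Union>w\<in>Orb. ball w 1)" by fastforce
    qed auto
    have "T \<in> {T :: 'h \<Rightarrow>\<^sub>L 'h. 1/4 \<le> (\<Sum>w\<in>N. inner (T w) w)}"
    proof (rule memI)
      fix u assume u: "u \<in> Orb"
      then obtain w where w: "w \<in> N" "dist w u < 1" using N(3) by fastforce
      have "(dist w u)\<^sup>2 < 1\<^sup>2" using w(2) by (intro power_strict_mono) auto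
      moreover have "inner w w = 1" "inner u u = 1"
        using norm_O u w(1) N(1) by (auto simp: norm_eq_1[symmetric])
      ultimately have "inner w u > 1/2"
        by (simp add: dist_norm power2_norm_eq_inner inner_diff_left inner_diff_right inner_commute)
      then have "(1/2)\<^sup>2 \<le> (Re (cinner w u))\<^sup>2"
        by (intro power_mono) (auto simp: inner_eq_Re_cinner)
      also have "\<dots> \<le> (cmod (cinner w u))\<^sup>2" by (simp add: cmod_power2)
      finally have "1/4 \<le> (cmod (cinner w u))\<^sup>2" by (simp add: power2_eq_square)
      also have sq: "inner (rank_one u w) w = (cmod (cinner w u))\<^sup>2" for w
      proof -
        have "cinner (rank_one u w) w = cinner w u * cnj (cinner w u)"
          using cinner_commute[of u w] by (simp add: cinner_scaleC_left)
        then show ?thesis by (simp add: inner_eq_Re_cinner complex_norm_square[symmetric])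
      qed
      then have "(cmod (cinner w u))\<^sup>2 \<le> (\<Sum>w\<in>N. inner (rank_one u w) w)"
        unfolding sq using N(2) w(1) by (intro member_le_sum) auto
      finally show "rank_one u \<in> {T :: 'h \<Rightarrow>\<^sub>L 'h. 1/4 \<le> (\<Sum>w\<in>N. inner (T w) w)}" by simp
    next
      have "linear (\<lambda>T :: 'h \<Rightarrow>\<^sub>L 'h. \<Sum>w\<in>N. inner (T w) w)"
        by (rule linearI) (simp_all add: blinfun.add_left blinfun.scaleR_left inner_add_left
            sum.distrib sum_distrib_left)
      from convex_linear_vimage[OF this convex_real_interval(1)[of "1/4"]]
      show "convex {T :: 'h \<Rightarrow>\<^sub>L 'h. 1/4 \<le> (\<Sum>w\<in>N. inner (T w) w)}" by (simp add: vimage_def)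
      show "closed {T :: 'h \<Rightarrow>\<^sub>L 'h. 1/4 \<le> (\<Sum>w\<in>N. inner (T w) w)}"
        by (intro closed_Collect_le continuous_intros)
    qed
    then show ?thesis by auto
  qed
  ultimately show thesis by (intro that[of T C]) auto
qed

text \<open>The invariant operator \<open>T\<close> attains its norm: by symmetry
  \<open>(norm (T x))\<^sup>2 \<le> norm (T (T x))\<close> for \<open>x\<close> in the unit ball, so a vector \<open>y\<close> of maximal norm in
  the closed image of the ball satisfies \<open>norm (T y) = (norm y)\<^sup>2\<close>, where \<open>norm y\<close> is the
  norm of \<open>T\<close>. Schur's lemma for the form \<open>(x, z) \<mapsto> cinner (T x) (T z)\<close> then makes
  \<open>T \<circ> T\<close> a nonzero multiple of the identity, while \<open>T\<close> maps the ball into a compact set.\<close>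

lemma compact_unit_ball: "compact (cball 0 1 :: 'h set)"
proof -
  obtain T :: "'h \<Rightarrow>\<^sub>L 'h" and C where T: "T \<noteq> 0" "compact C" "\<And>x. norm x \<le> 1 \<Longrightarrow> T x \<in> C"
    and sym: "\<And>x y. cinner (T x) y = cinner x (T y)"
    and scale: "\<And>c x. T (c *\<^sub>C x) = c *\<^sub>C T x"
    and inv: "\<And>g x. g \<in> carrier G \<Longrightarrow> T (\<pi> g x) = \<pi> g (T x)"
    by (rule invariant_compact_operator) blast
  define E where "E = closure (T ` cball 0 1)"
  have "E \<subseteq> C" unfolding E_def using T(2,3) by (intro closure_minimal compact_imp_closed) auto
  then have "compact E"
    using compact_Int_closed[OF T(2), of E] by (simp add: E_def inf.absorb2)
  moreover have T_E: "T x \<in> E" if "norm x \<le> 1" for x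
    unfolding E_def by (rule subsetD[OF closure_subset]) (use that in auto)
  moreover have "E \<noteq> {}" using T_E[of 0] by auto
  ultimately obtain y where y: "y \<in> E" "\<And>z. z \<in> E \<Longrightarrow> norm z \<le> norm y"
    using continuous_attains_sup[of E norm] by (auto intro: continuous_intros)
  have le: "norm (T x) \<le> norm y * norm x" for x
  proof (cases "x = 0")
    case False
    have "norm (T (x /\<^sub>R norm x)) \<le> norm y" using T_E y(2) False by simp
    then show ?thesis using False by (simp add: blinfun.scaleR_right field_simps)
  qed (simp add: blinfun.zero_right)
  then have "y \<noteq> 0" using T(1) by (metis blinfun_eqI zero_blinfun.rep_eq mult_zero_left norm_le_zero_iff norm_zero)
  have "E \<subseteq> {z. (norm z)\<^sup>2 \<le> norm (T z)}" unfolding E_def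
  proof (rule closure_minimal)
    show "T ` cball 0 1 \<subseteq> {z. (norm z)\<^sup>2 \<le> norm (T z)}"
    proof clarify
      fix x :: 'h assume x: "x \<in> cball 0 1"
      have "(norm (T x))\<^sup>2 = cmod (cinner (T (T x)) x)"
        unfolding sym[of "T x"] cinner_self by (simp add: norm_power)
      also have "\<dots> \<le> norm (T (T x)) * norm x" by (rule norm_cinner_le)
      also have "\<dots> \<le> norm (T (T x)) * 1" using x by (intro mult_left_mono) auto
      finally show "(norm (T x))\<^sup>2 \<le> norm (T (T x))" by simp
    qed
    show "closed {z. (norm z)\<^sup>2 \<le> norm (T z)}" by (intro closed_Collect_le continuous_intros)
  qed
  then have "norm (T y) = norm y * norm y" using y(1) le[of y] by (auto simp: power2_eq_square intro: antisym)
  define r where "r = (norm y)\<^sup>2"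
  have r: "r > 0" using \<open>y \<noteq> 0\<close> by (simp add: r_def)
  have form: "cinner (T x) (T z) = complex_of_real r * cinner x z" for x z
  proof (rule invariant_form_eq_multiple_of_cinner[OF irr cinner_rep surj_rep,
        where b = "\<lambda>x z. cinner (T x) (T z)" and v = y])
    show "cinner (T x) (T z) = cnj (cinner (T z) (T x))" for x z by (rule cinner_commute)
    show "continuous_on UNIV (\<lambda>x. cinner (T x) (T z))" for z by (intro continuous_intros)
    show "cinner (T (\<pi> g x)) (T (\<pi> g z)) = cinner (T x) (T z)" if "g \<in> carrier G" for g x z
      using that by (simp add: inv cinner_rep)
    show "Re (cinner (T x) (T x)) \<le> r * (norm x)\<^sup>2" for x
      using power_mono[OF le[of x], of 2] by (simp add: cinner_self r_def power_mult_distrib)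
    show "Re (cinner (T y) (T y)) = r * (norm y)\<^sup>2"
      using \<open>norm (T y) = norm y * norm y\<close> by (simp add: cinner_self r_def power2_eq_square)
  qed (use \<open>y \<noteq> 0\<close> in \<open>simp_all add: blinfun.add_right cinner_add_left scale cinner_scaleC_left\<close>)
  have square: "T (T x) = r *\<^sub>R x" for x
    by (rule cinner_ext) (simp add: sym[of "T x"] form scaleR_scaleC cinner_scaleC_left)
  have "cball 0 1 \<subseteq> (\<lambda>z. (1/r) *\<^sub>R T z) ` C"
  proof
    fix x :: 'h assume "x \<in> cball 0 1"
    then have "T x \<in> C" "x = (1/r) *\<^sub>R T (T x)" using T(3) r by (auto simp: square)
    then show "x \<in> (\<lambda>z. (1/r) *\<^sub>R T z) ` C" by blast
  qed
  moreover have "compact ((\<lambda>z. (1/r) *\<^sub>R T z) ` C)"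
    using T(2) by (intro compact_continuous_image continuous_intros)
  ultimately show ?thesis
    using compact_Int_closed[of _ "cball 0 1"] by (metis closed_cball inf.absorb2)
qed

end

section \<open>Polynomials in an operator and common eigenvectors\<close>

lemma bounded_clinear_add: "bounded_clinear T \<Longrightarrow> T (x + y) = T x + T y"
  by (simp add: bounded_clinear_def linear_add bounded_linear.linear)

lemma bounded_clinear_scaleC: "bounded_clinear T \<Longrightarrow> T (c *\<^sub>C x) = c *\<^sub>C T x"
  by (simp add: bounded_clinear_def)

lemma bounded_clinear_zero: "bounded_clinear T \<Longrightarrow> T 0 = 0"
  by (simp add: bounded_clinear_def linear_0 bounded_linear.linear)

text \<open>Horner's scheme for the value of \<open>p\<close> at \<open>T\<close>, applied to \<open>x\<close>.\<close>

definition op_poly :: "complex poly \<Rightarrow> ('h::chilbert_space \<Rightarrow> 'h) \<Rightarrow> 'h \<Rightarrow> 'h"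
  where "op_poly p T x = foldr (\<lambda>a y. a *\<^sub>C x + T y) (coeffs p) 0"

lemma op_poly_0 [simp]: "op_poly 0 T x = 0"
  by (simp add: op_poly_def)

lemma op_poly_pCons [simp]:
  "bounded_clinear T \<Longrightarrow> op_poly (pCons a p) T x = a *\<^sub>C x + T (op_poly p T x)"
  by (auto simp: op_poly_def cCons_def bounded_clinear_zero)

lemma op_poly_add:
  assumes "bounded_clinear T"
  shows "op_poly (p + q) T x = op_poly p T x + op_poly q T x"
  by (induction p q rule: poly_induct2)
    (use assms in \<open>simp_all add: scaleC_add_left bounded_clinear_add algebra_simps\<close>)

lemma op_poly_smult:
  assumes "bounded_clinear T"
  shows "op_poly (smult c p) T x = c *\<^sub>C op_poly p T x"
  by (induction p)
    (use assms in \<open>simp_all add: scaleC_add_right scaleC_scaleC bounded_clinear_scaleC\<close>)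

lemma op_poly_sum:
  assumes "bounded_clinear T"
  shows "op_poly (sum p I) T x = (\<Sum>i\<in>I. op_poly (p i) T x)"
  by (induction I rule: infinite_finite_induct) (use assms in \<open>simp_all add: op_poly_add\<close>)

lemma op_poly_monom:
  assumes "bounded_clinear T"
  shows "op_poly (monom c n) T x = c *\<^sub>C (T ^^ n) x"
  by (induction n) (use assms in \<open>simp_all add: monom_0 monom_Suc bounded_clinear_scaleC
      bounded_clinear_zero\<close>)

lemma op_poly_eigenvector:
  assumes "bounded_clinear T" "T x = a *\<^sub>C x"
  shows "op_poly p T x = poly p a *\<^sub>C x"
  by (induction p) (use assms in \<open>simp_all add: scaleC_add_left bounded_clinear_scaleC
      scaleC_scaleC mult.commute\<close>)

lemma op_poly_in_invariant_subspace:
  assumes "bounded_clinear T" "csubspace V" "T ` V \<subseteq> V" "x \<in> V"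
  shows "op_poly p T x \<in> V"
  by (induction p)
    (use assms in \<open>auto intro: complex_vector.subspace_0 complex_vector.subspace_add
      complex_vector.subspace_scale\<close>)

text \<open>The constant coefficient has to be \<open>0\<close> since the identity may be missing from a
  subalgebra.\<close>

lemma op_poly_in_subalgebra:
  assumes A: "subalgebra A" and T: "T \<in> A"
  shows "op_poly (pCons 0 q) T \<in> A"
proof (induction q)
  case 0
  have "op_poly (pCons 0 0) T = (\<lambda>x. 0)" by (simp add: fun_eq_iff)
  then show ?case using A by (simp add: subalgebra_def)
next
  case (pCons a q)
  have T': "bounded_clinear T" using A T by (auto simp: subalgebra_def)
  have "op_poly (pCons 0 (pCons a q)) T = (\<lambda>x. a *\<^sub>C T x + (T \<circ> op_poly (pCons 0 q) T) x)"
    using T' by (simp add: fun_eq_iff bounded_clinear_add bounded_clinear_scaleC)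
  moreover have "(\<lambda>x. a *\<^sub>C T x) \<in> A" "T \<circ> op_poly (pCons 0 q) T \<in> A"
    using A T pCons.IH by (simp_all add: subalgebra_def)
  moreover have "(\<lambda>x. S x + U x) \<in> A" if "S \<in> A" "U \<in> A" for S U
    using A that by (simp add: subalgebra_def)
  ultimately show ?case by metis
qed

lemma polynomial_interpolation:
  fixes f :: "complex \<Rightarrow> complex"
  assumes "finite S"
  shows "\<exists>p. \<forall>z\<in>S. poly p z = f z"
  using assms
proof (induction S)
  case (insert a S)
  then obtain p where p: "\<forall>z\<in>S. poly p z = f z" by blast
  define m where "m = (\<Prod>s\<in>S. [:-s, 1:])"
  have m: "poly m z = (\<Prod>s\<in>S. z - s)" for z by (simp add: m_def poly_prod)
  have "poly m a \<noteq> 0" "\<forall>z\<in>S. poly m z = 0" using insert.hyps by (auto simp: m)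
  then have "\<forall>z\<in>insert a S. poly (p + smult ((f a - poly p a) / poly m a) m) z = f z"
    using p by auto
  then show ?case by blast
qed simp

text \<open>The powers of \<open>T\<close> applied to \<open>v\<close> are linearly dependent, so a nonzero polynomial \<open>p\<close> of
  minimal degree annihilates \<open>v\<close>. If \<open>a\<close> is a root of \<open>p\<close>, then dividing \<open>p\<close> by the linear factor of \<open>a\<close>
  gives a polynomial that maps \<open>v\<close> to an eigenvector for \<open>a\<close>.\<close>

lemma eigenvector_in_invariant_subspace:
  fixes T :: "'h::chilbert_space \<Rightarrow> 'h"
  assumes T: "bounded_clinear T" and F: "finite F" "complex_vector.span F = (UNIV :: 'h set)"
    and V: "csubspace V" "T ` V \<subseteq> V" "v \<in> V" "v \<noteq> 0"
  obtains a w where "w \<in> V" "w \<noteq> 0" "T w = a *\<^sub>C w"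
proof -
  define f where "f i = (T ^^ i) v" for i
  have "\<exists>p. p \<noteq> 0 \<and> op_poly p T v = 0"
  proof (cases "inj_on f {..card F}")
    case True
    have "complex_vector.dependent (f ` {..card F})"
    proof (rule ccontr)
      assume "\<not> complex_vector.dependent (f ` {..card F})"
      then have "card (f ` {..card F}) \<le> card F"
        using complex_vector.independent_span_bound[OF F(1)] F(2) by auto
      then show False using card_image[OF True] by simp
    qed
    then obtain u i where u: "u (f i) \<noteq> 0" "i \<le> card F"
      "(\<Sum>w\<in>f ` {..card F}. u w *\<^sub>C w) = 0"
      by (subst (asm) complex_vector.dependent_finite) auto
    define p where "p = (\<Sum>i\<le>card F. monom (u (f i)) i)"
    have "coeff p i = u (f i)" using u(2) by (simp add: p_def coeff_sum)
    then have "p \<noteq> 0" using u(1) by auto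
    moreover have "op_poly p T v = 0"
      using u(3) T sum.reindex[OF True, of "\<lambda>w. u w *\<^sub>C w"]
      by (simp add: p_def op_poly_sum op_poly_monom f_def)
    ultimately show ?thesis by blast
  next
    case False
    then obtain i j where ij: "i \<noteq> j" "f i = f j" by (auto simp: inj_on_def)
    define p where "p = monom 1 i + monom (- 1 :: complex) j"
    have "coeff p i = 1" using ij(1) by (simp add: p_def)
    then have "p \<noteq> 0" by auto
    moreover have "op_poly p T v = f i + (- 1) *\<^sub>C f j"
      using T by (simp only: p_def op_poly_add op_poly_monom f_def scaleC_one)
    then have "op_poly p T v = 0"
      using ij(2) complex_vector.scale_minus_left[of 1 "f j"] by (simp add: scaleC_one)
    ultimately show ?thesis by blast
  qed
  then obtain p where p: "p \<noteq> 0" "op_poly p T v = 0"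
    and min: "\<And>q. q \<noteq> 0 \<Longrightarrow> op_poly q T v = 0 \<Longrightarrow> degree p \<le> degree q"
    using ex_has_least_nat[of "\<lambda>p. p \<noteq> 0 \<and> op_poly p T v = 0" _ degree] by blast
  have "degree p \<noteq> 0"
  proof
    assume "degree p = 0"
    then obtain c where "p = [:c:]" using degree_eq_zeroE by blast
    then show False using p V(4) T by (simp add: bounded_clinear_zero)
  qed
  then obtain a where "poly p a = 0"
    using fundamental_theorem_of_algebra[of p] by (auto simp: constant_degree)
  then obtain q where q: "p = [:- a, 1:] * q" by (auto simp: poly_eq_0_iff_dvd elim: dvdE)
  then have "q \<noteq> 0" using p(1) by auto
  then have "degree p = Suc (degree q)" unfolding q by (subst degree_mult_eq) auto
  then have "op_poly q T v \<noteq> 0" using min[OF \<open>q \<noteq> 0\<close>] by auto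
  moreover have "op_poly p T v = T (op_poly q T v) - a *\<^sub>C op_poly q T v"
    using T by (simp add: q op_poly_add op_poly_smult complex_vector.scale_minus_left
        bounded_clinear_zero del: smult_minus_left)
  then have "T (op_poly q T v) = a *\<^sub>C op_poly q T v" using p(2) by simp
  moreover have "op_poly q T v \<in> V" using T V by (intro op_poly_in_invariant_subspace)
  ultimately show thesis by (intro that)
qed

text \<open>The eigenspaces of one operator are invariant under all the others. A nonzero invariant
  subspace of minimal dimension therefore lies in a single eigenspace of each operator.\<close>

lemma commuting_operators_common_eigenvector:
  fixes A :: "('h::chilbert_space \<Rightarrow> 'h) set"
  assumes A: "\<And>T. T \<in> A \<Longrightarrow> bounded_clinear T" and comm: "abelian A"
    and F: "finite F" "complex_vector.span F = (UNIV :: 'h set)" and ne: "(UNIV :: 'h set) \<noteq> {0}"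
  obtains v where "v \<noteq> 0" "\<And>T. T \<in> A \<Longrightarrow> \<exists>a. T v = a *\<^sub>C v"
proof -
  obtain B where B: "B \<subseteq> F" "\<not> complex_vector.dependent B" "F \<subseteq> complex_vector.span B"
    using complex_vector.maximal_independent_subset by blast
  have "complex_vector.span B = UNIV"
    using B(3) F(2) complex_vector.span_minimal[OF B(3) complex_vector.subspace_span] by auto
  then interpret fd: finite_dimensional_vector_space "scaleC :: complex \<Rightarrow> 'h \<Rightarrow> 'h" B
    using B F(1) by unfold_locales (auto intro: finite_subset)
  define invariant where "invariant V \<longleftrightarrow> csubspace V \<and> V \<noteq> {0} \<and> (\<forall>T\<in>A. T ` V \<subseteq> V)" for V :: "'h set"
  have "invariant UNIV" using ne by (simp add: invariant_def)
  then obtain V where V: "invariant V" and min: "\<And>W. invariant W \<Longrightarrow> complex_vector.dim V \<le> complex_vector.dim W"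
    using ex_has_least_nat[of invariant UNIV complex_vector.dim] by blast
  have csub: "csubspace V" using V by (simp add: invariant_def)
  then obtain v where v: "v \<in> V" "v \<noteq> 0"
    using V complex_vector.subspace_0[OF csub] unfolding invariant_def by auto
  have "\<exists>a. T v = a *\<^sub>C v" if T: "T \<in> A" for T
  proof -
    have "T ` V \<subseteq> V" using V T by (simp add: invariant_def)
    then obtain a w where w: "w \<in> V" "w \<noteq> 0" "T w = a *\<^sub>C w"
      using eigenvector_in_invariant_subspace[OF A[OF T] F csub _ v] by metis
    define W where "W = {x \<in> V. T x = a *\<^sub>C x}"
    have "csubspace W"
    proof (rule csubspaceI)
      show "0 \<in> W" using csub A[OF T] by (simp add: W_def complex_vector.subspace_0 bounded_clinear_zero)
      show "x + y \<in> W" if "x \<in> W" "y \<in> W" for x y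
        using that csub A[OF T] by (simp add: W_def complex_vector.subspace_add bounded_clinear_add scaleC_add_right)
      show "c *\<^sub>C x \<in> W" if "x \<in> W" for c x
        using that csub A[OF T] by (simp add: W_def complex_vector.subspace_scale bounded_clinear_scaleC scaleC_scaleC mult.commute)
    qed
    moreover have "w \<in> W" using w by (simp add: W_def)
    then have "W \<noteq> {0}" using w(2) by auto
    moreover have "S ` W \<subseteq> W" if S: "S \<in> A" for S
    proof clarify
      fix x assume x: "x \<in> W"
      have "T (S x) = S (T x)" using comm S T unfolding abelian_def by (metis comp_apply)
      also have "\<dots> = a *\<^sub>C S x" using x A[OF S] by (simp add: W_def bounded_clinear_scaleC)
      finally show "S x \<in> W" using V S x by (auto simp: W_def invariant_def)
    qed
    ultimately have "complex_vector.dim V \<le> complex_vector.dim W"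
      by (intro min) (simp add: invariant_def)
    then have "W = V"
      using fd.subspace_dim_equal[folded csubspace_def, of W V] \<open>csubspace W\<close> csub
      by (simp add: W_def)
    then show ?thesis using v(1) by (auto simp: W_def)
  qed
  then show thesis using v(2) that by blast
qed

section \<open>Weight spaces of an inductive algebra\<close>

context compact_irreducible_rep
begin

lemma finite_real_spanning_set:
  obtains F :: "'h set" where "finite F" "span F = UNIV"
  using compact_cball_imp_finite_spanning_set[OF compact_unit_ball] .

lemma finite_complex_spanning_set:
  obtains F :: "'h set" where "finite F" "complex_vector.span F = UNIV"
proof -
  obtain F :: "'h set" where F: "finite F" "span F = UNIV" by (rule finite_real_spanning_set)
  have "span F \<subseteq> complex_vector.span F"
  proof (rule span_minimal)
    show "subspace (complex_vector.span F)"
      by (rule subspaceI) (auto simp: scaleR_scaleC complex_vector.span_zero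
          complex_vector.span_add complex_vector.span_scale)
  qed (rule complex_vector.span_superset)
  then show thesis using F that by blast
qed

lemma closed_csubspace:
  fixes V :: "'h set"
  assumes "csubspace V"
  shows "closed V"
proof -
  have "subspace V"
    by (rule subspaceI) (use assms in \<open>auto simp: scaleR_scaleC complex_vector.subspace_0
        complex_vector.subspace_add complex_vector.subspace_scale\<close>)
  then show ?thesis
    using finite_real_spanning_set closed_subspace_if_finite_spanning_set by metis
qed

lemma rep_zero: "g \<in> carrier G \<Longrightarrow> \<pi> g 0 = 0"
  using bounded_linear_rep by (intro linear_0 bounded_linear.linear)

text \<open>In a direct decomposition whose summands are permuted by the group, the form
  \<open>(x, y) \<mapsto> (\<Sum>W\<in>\<W>. cinner (P W x) (P W y))\<close> is invariant, hence a multiple of the inner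
  product. The summands are orthogonal for this form by construction.\<close>

lemma permuted_direct_summands_orthogonal:
  fixes \<W> :: "'h set set" and P :: "'h set \<Rightarrow> 'h \<Rightarrow> 'h"
  assumes fin: "finite \<W>" and span: "complex_vector.span (\<Union>\<W>) = UNIV"
    and perm: "\<And>g W. g \<in> carrier G \<Longrightarrow> W \<in> \<W> \<Longrightarrow> \<pi> g ` W \<in> \<W>"
    and P_add: "\<And>W x y. P W (x + y) = P W x + P W y"
    and P_scale: "\<And>W c x. P W (c *\<^sub>C x) = c *\<^sub>C P W x"
    and P_same: "\<And>W x. W \<in> \<W> \<Longrightarrow> x \<in> W \<Longrightarrow> P W x = x"
    and P_other: "\<And>W W' x. W \<in> \<W> \<Longrightarrow> W' \<in> \<W> \<Longrightarrow> W \<noteq> W' \<Longrightarrow> x \<in> W' \<Longrightarrow> P W x = 0"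
    and W: "W1 \<in> \<W>" "W2 \<in> \<W>" "W1 \<noteq> W2" "x1 \<in> W1" "x2 \<in> W2"
  shows "cinner x1 x2 = 0"
proof (cases "x1 = 0")
  case False
  define b where "b x y = (\<Sum>W\<in>\<W>. cinner (P W x) (P W y))" for x y
  have P_zero: "P W 0 = 0" for W using P_scale[of W 0 0] by simp
  have image_inv: "\<pi> (inv g) ` \<pi> g ` W = W" if "g \<in> carrier G" for g W
    using that by (force simp: image_image rep_inv_left)
  have P_rep: "P (\<pi> g ` W) (\<pi> g x) = \<pi> g (P W x)" if g: "g \<in> carrier G" and W: "W \<in> \<W>" for g W x
  proof -
    define S where "S = {x. P (\<pi> g ` W) (\<pi> g x) = \<pi> g (P W x)}"
    have "csubspace S"
      by (rule csubspaceI) (auto simp: S_def P_zero rep_zero P_add rep_add P_scale rep_scaleC g)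
    moreover have "\<Union>\<W> \<subseteq> S"
    proof clarify
      fix y V assume V: "y \<in> V" "V \<in> \<W>"
      show "y \<in> S"
      proof (cases "V = W")
        case True
        then show ?thesis using V perm g W by (simp add: S_def P_same)
      next
        case ne: False
        then have "\<pi> g ` V \<noteq> \<pi> g ` W" using image_inv[OF g] by metis
        then show ?thesis
          using V perm g W ne P_other[of "\<pi> g ` W" "\<pi> g ` V"] P_other[of W V]
          by (simp add: S_def rep_zero)
      qed
    qed
    ultimately have "complex_vector.span (\<Union>\<W>) \<subseteq> S" by (intro complex_vector.span_minimal)
    then show ?thesis using span by (auto simp: S_def)
  qed
  have b_inv: "b (\<pi> g x) (\<pi> g y) = b x y" if g: "g \<in> carrier G" for g x y
  proof -
    have "bij_betw ((`) (\<pi> g)) \<W> \<W>"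
      by (rule bij_betw_byWitness[where f' = "(`) (\<pi> (inv g))"])
        (use g perm image_inv[of g] image_inv[of "inv g"] in auto)
    then have "b (\<pi> g x) (\<pi> g y) = (\<Sum>W\<in>\<W>. cinner (P (\<pi> g ` W) (\<pi> g x)) (P (\<pi> g ` W) (\<pi> g y)))"
      unfolding b_def by (rule sum.reindex_bij_betw[symmetric])
    also have "\<dots> = b x y" unfolding b_def by (intro sum.cong) (simp_all add: P_rep g cinner_rep)
    finally show ?thesis .
  qed
  obtain F :: "'h set" where F: "finite F" "span F = UNIV" by (rule finite_real_spanning_set)
  have cont_P: "continuous_on S (P W)" for S W
    by (rule linear_continuous_if_finite_spanning_set[OF F], rule linearI)
      (simp_all add: P_add P_scale scaleR_scaleC)
  have "sphere (0::'h) 1 = cball 0 1 \<inter> {x. norm x = 1}" by auto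
  moreover have "closed {x::'h. norm x = 1}" by (intro closed_Collect_eq continuous_intros)
  ultimately have "compact (sphere (0::'h) 1)"
    using compact_Int_closed[OF compact_unit_ball] by metis
  moreover have "x1 /\<^sub>R norm x1 \<in> sphere 0 1" using False by simp
  moreover have "continuous_on (sphere 0 1) (\<lambda>x. Re (b x x))"
    unfolding b_def by (intro continuous_intros cont_P)
  ultimately obtain v where v: "v \<in> sphere 0 1" "\<And>x. x \<in> sphere 0 1 \<Longrightarrow> Re (b x x) \<le> Re (b v v)"
    using continuous_attains_sup[of "sphere 0 1" "\<lambda>x. Re (b x x)"] by blast
  define c where "c = Re (b v v)"
  have form: "b x y = complex_of_real c * cinner x y" for x y
  proof (rule invariant_form_eq_multiple_of_cinner[OF irr cinner_rep surj_rep, where b = b and v = v])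
    show add: "b (x + y) z = b x z + b y z" for x y z
      by (simp add: b_def P_add cinner_add_left sum.distrib)
    show scale: "b (a *\<^sub>C x) y = a * b x y" for a x y
      by (simp add: b_def P_scale cinner_scaleC_left sum_distrib_left)
    show herm: "b x y = cnj (b y x)" for x y
      unfolding b_def cnj_sum by (intro sum.cong refl cinner_commute)
    show "continuous_on UNIV (\<lambda>x. b x y)" for y
      unfolding b_def by (intro continuous_intros cont_P)
    show "Re (b x x) \<le> c * (norm x)\<^sup>2" for x
    proof (cases "x = 0")
      case True
      then show ?thesis by (simp add: b_def P_zero)
    next
      case False
      define u where "u = x /\<^sub>R norm x"
      have x: "x = complex_of_real (norm x) *\<^sub>C u"
        using False by (simp add: u_def scaleR_scaleC[symmetric])
      have "b x x = complex_of_real (norm x) * b u x" by (subst x, subst scale) simp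
      also have "b u x = cnj (complex_of_real (norm x) * b u u)"
        by (subst herm, subst x, subst scale) simp
      finally have "Re (b x x) = Re (b u u) * (norm x)\<^sup>2" by (simp add: power2_eq_square)
      moreover have "Re (b u u) \<le> c" unfolding c_def using False by (intro v(2)) (simp add: u_def)
      ultimately show ?thesis by (simp add: mult_right_mono)
    qed
  qed (use v b_inv in \<open>auto simp: c_def\<close>)
  have b_left: "b x y = cinner x (P W y)" if "W \<in> \<W>" "x \<in> W" for W x y
  proof -
    have "b x y = (\<Sum>V\<in>\<W>. if V = W then cinner x (P W y) else 0)"
      unfolding b_def by (intro sum.cong refl) (use that P_same P_other in auto)
    then show ?thesis using fin that(1) by simp
  qed
  have "b x1 x1 = cinner x1 x1" using b_left[OF W(1,4)] P_same[OF W(1,4)] by simp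
  then have "c \<noteq> 0" using form[of x1 x1] False by (auto simp: cinner_self)
  moreover have "b x1 x2 = 0" using b_left[OF W(1,4), of x2] P_other[OF W(1-3,5)] by simp
  ultimately show ?thesis using form[of x1 x2] by simp
qed simp

end

locale compact_irreducible_inductive_algebra = compact_irreducible_rep G X \<pi>
  for G (structure) and X and \<pi> :: "'a \<Rightarrow> 'h::chilbert_space \<Rightarrow> 'h" +
  fixes A :: "('h \<Rightarrow> 'h) set"
  assumes ind_alg: "inductive_algebra G \<pi> A"
begin

lemma bounded_clinear_A: "T \<in> A \<Longrightarrow> bounded_clinear T"
  using ind_alg by (auto simp: inductive_algebra_def subalgebra_def)

lemma conj_in_A: "g \<in> carrier G \<Longrightarrow> T \<in> A \<Longrightarrow> \<pi> g \<circ> T \<circ> \<pi> (inv g) \<in> A"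
  using ind_alg by (fastforce simp: inductive_algebra_def inv_into_rep)

definition weight_space :: "(('h \<Rightarrow> 'h) \<Rightarrow> complex) \<Rightarrow> 'h set"
  where "weight_space \<mu> = {v. \<forall>T\<in>A. T v = \<mu> T *\<^sub>C v}"

text \<open>The weight spaces are indexed by themselves, as sets of vectors. Then the group acts on them
  by images, and functions \<open>\<mu>\<close> that agree on \<open>A\<close> give the same index.\<close>

definition weight_spaces :: "'h set set"
  where "weight_spaces = range weight_space - {{0}}"

lemma csubspace_weight_space: "csubspace (weight_space \<mu>)"
  by (rule csubspaceI)
    (auto simp: weight_space_def bounded_clinear_A bounded_clinear_zero bounded_clinear_add
      bounded_clinear_scaleC scaleC_add_right scaleC_scaleC mult.commute)

lemma weight_space_cong: "(\<And>T. T \<in> A \<Longrightarrow> \<mu> T = \<mu>' T) \<Longrightarrow> weight_space \<mu> = weight_space \<mu>'"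
  by (simp add: weight_space_def)

lemma weight_unique:
  assumes "v \<in> weight_space \<mu>" "v \<in> weight_space \<mu>'" "v \<noteq> 0" "T \<in> A"
  shows "\<mu> T = \<mu>' T"
proof -
  have "\<mu> T *\<^sub>C v = \<mu>' T *\<^sub>C v" using assms by (simp add: weight_space_def)
  then show ?thesis using assms(3) by (simp add: complex_vector.scale_cancel_right)
qed

lemma weight_spaces_disjoint:
  assumes "W \<in> weight_spaces" "W' \<in> weight_spaces" "v \<in> W" "v \<in> W'" "v \<noteq> 0"
  shows "W = W'"
proof -
  obtain \<mu> \<mu>' where "W = weight_space \<mu>" "W' = weight_space \<mu>'"
    using assms(1,2) by (auto simp: weight_spaces_def)
  then show ?thesis using assms(3-5) weight_unique by (metis weight_space_cong)
qed

lemma rep_weight_space_subset: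
  assumes g: "g \<in> carrier G"
  shows "\<pi> g ` weight_space \<mu> \<subseteq> weight_space (\<lambda>T. \<mu> (\<pi> (inv g) \<circ> T \<circ> \<pi> g))"
proof clarify
  fix v assume v: "v \<in> weight_space \<mu>"
  have "T (\<pi> g v) = \<mu> (\<pi> (inv g) \<circ> T \<circ> \<pi> g) *\<^sub>C \<pi> g v" if T: "T \<in> A" for T
  proof -
    have "\<pi> (inv g) \<circ> T \<circ> \<pi> g \<in> A" using conj_in_A[of "inv g" T] g T by simp
    then have "\<pi> (inv g) (T (\<pi> g v)) = \<mu> (\<pi> (inv g) \<circ> T \<circ> \<pi> g) *\<^sub>C v"
      using v by (auto simp: weight_space_def)
    then have "\<pi> g (\<pi> (inv g) (T (\<pi> g v))) = \<pi> g (\<mu> (\<pi> (inv g) \<circ> T \<circ> \<pi> g) *\<^sub>C v)" by simp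
    then show ?thesis using g by (simp add: rep_inv_right rep_scaleC)
  qed
  then show "\<pi> g v \<in> weight_space (\<lambda>T. \<mu> (\<pi> (inv g) \<circ> T \<circ> \<pi> g))" by (simp add: weight_space_def)
qed

text \<open>The other inclusion is \<open>rep_weight_space_subset\<close> for the inverse of \<open>g\<close>.\<close>

lemma rep_weight_space:
  assumes g: "g \<in> carrier G"
  shows "\<pi> g ` weight_space \<mu> = weight_space (\<lambda>T. \<mu> (\<pi> (inv g) \<circ> T \<circ> \<pi> g))"
proof
  show "weight_space (\<lambda>T. \<mu> (\<pi> (inv g) \<circ> T \<circ> \<pi> g)) \<subseteq> \<pi> g ` weight_space \<mu>"
  proof
    fix v assume "v \<in> weight_space (\<lambda>T. \<mu> (\<pi> (inv g) \<circ> T \<circ> \<pi> g))"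
    then have "\<pi> (inv g) v \<in> weight_space (\<lambda>T. \<mu> (\<pi> (inv g) \<circ> (\<pi> g \<circ> T \<circ> \<pi> (inv g)) \<circ> \<pi> g))"
      using rep_weight_space_subset[of "inv g" "\<lambda>T. \<mu> (\<pi> (inv g) \<circ> T \<circ> \<pi> g)"] g by auto
    also have "(\<lambda>T. \<mu> (\<pi> (inv g) \<circ> (\<pi> g \<circ> T \<circ> \<pi> (inv g)) \<circ> \<pi> g)) = \<mu>"
      using g by (simp add: comp_def rep_inv_left)
    finally have "\<pi> g (\<pi> (inv g) v) \<in> \<pi> g ` weight_space \<mu>" by (rule imageI)
    then show "v \<in> \<pi> g ` weight_space \<mu>" using g by (simp add: rep_inv_right)
  qed
qed (rule rep_weight_space_subset[OF g])

lemma rep_weight_spaces: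
  assumes g: "g \<in> carrier G" and W: "W \<in> weight_spaces"
  shows "\<pi> g ` W \<in> weight_spaces"
proof -
  obtain \<mu> where \<mu>: "W = weight_space \<mu>" "W \<noteq> {0}" using W by (auto simp: weight_spaces_def)
  then obtain v where "v \<in> W" "v \<noteq> 0"
    using complex_vector.subspace_0[OF csubspace_weight_space] by blast
  then have "\<pi> g v \<in> \<pi> g ` W" "\<pi> g v \<noteq> 0" using norm_rep[OF g, of v] by auto
  then have "\<pi> g ` W \<noteq> {0}" by blast
  then show ?thesis using rep_weight_space[OF g] by (simp add: \<mu>(1) weight_spaces_def)
qed

text \<open>The group permutes the weight spaces, so their span is invariant; a common eigenvector of
  the algebra shows that it is not \<open>{0}\<close>.\<close>

lemma span_weight_spaces: "complex_vector.span (\<Union>weight_spaces) = UNIV"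
proof -
  let ?S = "complex_vector.span (\<Union>weight_spaces)"
  have "\<pi> g ` ?S \<subseteq> ?S" if g: "g \<in> carrier G" for g
  proof -
    have "?S \<subseteq> {x. \<pi> g x \<in> ?S}"
    proof (rule complex_vector.span_minimal)
      show "\<Union>weight_spaces \<subseteq> {x. \<pi> g x \<in> ?S}"
        using rep_weight_spaces[OF g] by (blast intro: complex_vector.span_base)
      show "csubspace {x. \<pi> g x \<in> ?S}"
        by (rule csubspaceI) (auto simp: g rep_zero rep_add rep_scaleC complex_vector.span_zero
            complex_vector.span_add complex_vector.span_scale)
    qed
    then show ?thesis by blast
  qed
  moreover have "csubspace ?S" by (rule complex_vector.subspace_span)
  ultimately have "?S = {0} \<or> ?S = UNIV"
    using irr closed_csubspace by (simp add: irreducible_rep_def)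
  moreover have "?S \<noteq> {0}"
  proof -
    obtain F :: "'h set" where F: "finite F" "complex_vector.span F = UNIV"
      by (rule finite_complex_spanning_set)
    have "abelian A" using ind_alg by (simp add: inductive_algebra_def)
    moreover have "(UNIV :: 'h set) \<noteq> {0}" using irr by (simp add: irreducible_rep_def)
    ultimately obtain v where v: "v \<noteq> 0" "\<And>T. T \<in> A \<Longrightarrow> \<exists>a. T v = a *\<^sub>C v"
      using commuting_operators_common_eigenvector[OF bounded_clinear_A _ F] by blast
    then obtain \<mu> where "\<And>T. T \<in> A \<Longrightarrow> T v = \<mu> T *\<^sub>C v" by metis
    then have "v \<in> weight_space \<mu>" by (simp add: weight_space_def)
    then have "v \<in> \<Union>weight_spaces" using v(1) by (auto simp: weight_spaces_def)
    then have "v \<in> ?S" by (rule complex_vector.span_base)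
    then show ?thesis using v(1) by auto
  qed
  ultimately show ?thesis by blast
qed

lemma weight_basis:
  obtains B where "finite B" "\<not> complex_vector.dependent B" "complex_vector.span B = UNIV"
    "B \<subseteq> \<Union>weight_spaces"
proof -
  obtain B where B: "B \<subseteq> \<Union>weight_spaces" "\<not> complex_vector.dependent B"
    "\<Union>weight_spaces \<subseteq> complex_vector.span B"
    using complex_vector.maximal_independent_subset by blast
  obtain F :: "'h set" where F: "finite F" "complex_vector.span F = UNIV"
    by (rule finite_complex_spanning_set)
  have "finite B" using complex_vector.independent_span_bound[OF F(1) B(2)] F(2) by simp
  moreover have "complex_vector.span B = UNIV"
    using complex_vector.span_minimal[OF B(3) complex_vector.subspace_span] span_weight_spaces by auto
  ultimately show thesis using B that by blast
qed

text \<open>A weight vector has vanishing coefficients at the basis vectors of other weights, so the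
  sums over the basis vectors in one weight space are the projections of a direct
  decomposition.\<close>

lemma weight_spaces_orthogonal:
  assumes W: "W1 \<in> weight_spaces" "W2 \<in> weight_spaces" "W1 \<noteq> W2" "x1 \<in> W1" "x2 \<in> W2"
  shows "cinner x1 x2 = 0"
proof -
  obtain B where B: "finite B" "\<not> complex_vector.dependent B" "complex_vector.span B = UNIV"
    "B \<subseteq> \<Union>weight_spaces"
    by (rule weight_basis)
  define r where "r = complex_vector.representation B"
  have r_sum: "(\<Sum>b\<in>B. r x b *\<^sub>C b) = x" for x
    unfolding r_def using B by (intro complex_vector.sum_representation_eq) auto
  have B_nonzero: "b \<noteq> 0" if "b \<in> B" for b
    using that B(2) complex_vector.dependent_zero by blast
  have r_other: "r x b = 0" if WW: "W \<in> weight_spaces" "x \<in> W" and b: "b \<in> B" "b \<notin> W" for x b W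
  proof -
    have "\<forall>d\<in>B. \<exists>\<mu>. d \<in> weight_space \<mu>" using B(4) by (auto simp: weight_spaces_def)
    then obtain e where e: "\<And>d. d \<in> B \<Longrightarrow> d \<in> weight_space (e d)" by metis
    obtain \<mu> where \<mu>: "W = weight_space \<mu>" using WW(1) by (auto simp: weight_spaces_def)
    obtain T where T: "T \<in> A" "e b T \<noteq> \<mu> T"
      using e[OF b(1)] b(2) weight_space_cong[of "e b" \<mu>] \<mu> by auto
    note lin = bounded_clinear_A[OF T(1)]
    have eT: "T d = e d T *\<^sub>C d" if "d \<in> B" for d
      using e[OF that] T(1) unfolding weight_space_def by blast
    have "T x = (\<Sum>d\<in>B. T (r x d *\<^sub>C d))"
      using lin linear_sum[of T "\<lambda>d. r x d *\<^sub>C d" B]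
      by (simp add: r_sum bounded_clinear_def bounded_linear.linear)
    also have "\<dots> = (\<Sum>d\<in>B. (r x d * e d T) *\<^sub>C d)"
      by (intro sum.cong refl)
        (simp add: bounded_clinear_scaleC[OF lin] eT scaleC_scaleC)
    finally have "T x = (\<Sum>d\<in>B. (r x d * e d T) *\<^sub>C d)" .
    moreover have "T x = (\<Sum>d\<in>B. (\<mu> T * r x d) *\<^sub>C d)"
    proof -
      have "T x = \<mu> T *\<^sub>C (\<Sum>d\<in>B. r x d *\<^sub>C d)"
        using WW(2) T(1) by (simp add: \<mu> weight_space_def r_sum)
      then show ?thesis by (simp add: complex_vector.scale_sum_right scaleC_scaleC)
    qed
    ultimately have "(\<Sum>d\<in>B. (r x d * (e d T - \<mu> T)) *\<^sub>C d) = 0"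
      by (simp add: right_diff_distrib complex_vector.scale_left_diff_distrib sum_subtractf mult.commute)
    then have "r x b * (e b T - \<mu> T) = 0"
      by (rule complex_vector.independentD[OF B(2,1) subset_refl _ b(1),
            where u = "\<lambda>d. r x d * (e d T - \<mu> T)"])
    then show ?thesis using T(2) by simp
  qed
  define P where "P W x = (\<Sum>b\<in>B \<inter> W. r x b *\<^sub>C b)" for W x
  have P_same: "P W x = x" if "W \<in> weight_spaces" "x \<in> W" for W x
  proof -
    have "P W x = (\<Sum>b\<in>B. r x b *\<^sub>C b)" unfolding P_def
      by (rule sum.mono_neutral_left) (use B(1) r_other[OF that] in auto)
    then show ?thesis by (simp add: r_sum)
  qed
  show ?thesis
  proof (rule permuted_direct_summands_orthogonal[OF _ span_weight_spaces rep_weight_spaces _ _ P_same _ W])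
    have "weight_spaces \<subseteq> (\<Union>b\<in>B. {W \<in> weight_spaces. b \<in> W})"
    proof
      fix W assume W: "W \<in> weight_spaces"
      then obtain x where x: "x \<in> W" "x \<noteq> 0"
        using complex_vector.subspace_0[OF csubspace_weight_space] unfolding weight_spaces_def by blast
      then have "P W x \<noteq> 0" using P_same W by simp
      then have "B \<inter> W \<noteq> {}" by (auto simp: P_def)
      then show "W \<in> (\<Union>b\<in>B. {W \<in> weight_spaces. b \<in> W})" using W by blast
    qed
    moreover have "finite {W \<in> weight_spaces. b \<in> W}" if b: "b \<in> B" for b
    proof -
      obtain W where "W \<in> weight_spaces" "b \<in> W" using B(4) b by blast
      then have "{W \<in> weight_spaces. b \<in> W} \<subseteq> {W}"
        using weight_spaces_disjoint B_nonzero[OF b] by blast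
      then show ?thesis by (rule finite_subset) simp
    qed
    ultimately show "finite weight_spaces" using B(1) by (meson finite_UN finite_subset)
    show "P W (x + y) = P W x + P W y" for W x y
      using B by (simp add: P_def r_def complex_vector.representation_add scaleC_add_left sum.distrib)
    show "P W (c *\<^sub>C x) = c *\<^sub>C P W x" for W c x
      using B by (simp add: P_def r_def complex_vector.representation_scale
          complex_vector.scale_sum_right scaleC_scaleC)
    show "P W x = 0" if "W \<in> weight_spaces" "W' \<in> weight_spaces" "W \<noteq> W'" "x \<in> W'" for W W' x
      unfolding P_def
    proof (rule sum.neutral, clarify)
      fix b assume b: "b \<in> B" "b \<in> W"
      then have "b \<notin> W'" using that weight_spaces_disjoint B_nonzero by blast
      then show "r x b *\<^sub>C b = 0" using r_other[OF that(2,4) b(1)] by simp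
    qed
  qed
qed

text \<open>Interpolation gives a polynomial \<open>p\<close> with \<open>poly p z = cnj z\<close> at the eigenvalues of \<open>T\<close>. By
  orthogonality of the weight spaces, the value of \<open>p\<close> at \<open>T\<close> is the adjoint. The additional node
  \<open>0\<close> makes the constant coefficient vanish, so that this operator lies in the algebra even if
  the identity does not.\<close>

lemma adjoint_in_A:
  assumes T: "T \<in> A"
  obtains S where "S \<in> A" "\<And>x y. cinner (T x) y = cinner x (S y)"
proof -
  obtain B where B: "finite B" "\<not> complex_vector.dependent B" "complex_vector.span B = UNIV"
    "B \<subseteq> \<Union>weight_spaces"
    by (rule weight_basis)
  have "\<forall>b\<in>B. \<exists>a. T b = a *\<^sub>C b"
    using B(4) T unfolding weight_spaces_def weight_space_def by blast
  then obtain e where e: "\<And>b. b \<in> B \<Longrightarrow> T b = e b *\<^sub>C b" by metis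
  have "finite (insert 0 (e ` B))" using B(1) by simp
  then obtain p where p: "\<And>z. z \<in> insert 0 (e ` B) \<Longrightarrow> poly p z = cnj z"
    using polynomial_interpolation[of "insert 0 (e ` B)" cnj] by blast
  obtain q where q: "p = pCons 0 q" using p[of 0] by (cases p) simp
  define S where "S = op_poly p T"
  have "subalgebra A" using ind_alg by (simp add: inductive_algebra_def)
  then have S: "S \<in> A" unfolding S_def q using T by (rule op_poly_in_subalgebra)
  note lin = bounded_clinear_A[OF T] bounded_clinear_A[OF S]
  have S_B: "S b = cnj (e b) *\<^sub>C b" if "b \<in> B" for b
    unfolding S_def using op_poly_eigenvector[OF lin(1) e[OF that]] p that by simp
  have BB: "cinner (T b) d = cinner b (S d)" if b: "b \<in> B" and d: "d \<in> B" for b d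
  proof (cases "cinner b d = 0")
    case False
    obtain V W where VW: "V \<in> weight_spaces" "W \<in> weight_spaces" "b \<in> V" "d \<in> W"
      using B(4) b d by blast
    then have "V = W" using weight_spaces_orthogonal False by blast
    then obtain \<mu> where "b \<in> weight_space \<mu>" "d \<in> weight_space \<mu>"
      using VW by (auto simp: weight_spaces_def)
    then have "e b *\<^sub>C b = \<mu> T *\<^sub>C b" "e d *\<^sub>C d = \<mu> T *\<^sub>C d"
      using T e[OF b] e[OF d] by (auto simp: weight_space_def)
    moreover have "b \<noteq> 0" "d \<noteq> 0" using False by auto
    ultimately have "e b = e d" by (simp add: complex_vector.scale_cancel_right)
    then show ?thesis using b d by (simp add: e S_B cinner_scaleC_left cinner_scaleC_right)
  qed (use b d in \<open>simp add: e S_B cinner_scaleC_left cinner_scaleC_right\<close>)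
  have "csubspace {x. cinner (T x) d = cinner x (S d)}" for d
    by (rule csubspaceI) (auto simp: lin bounded_clinear_zero bounded_clinear_add
        bounded_clinear_scaleC cinner_add_left cinner_scaleC_left)
  then have "complex_vector.span B \<subseteq> {x. cinner (T x) d = cinner x (S d)}" if "d \<in> B" for d
    using BB that by (intro complex_vector.span_minimal) auto
  then have "cinner (T x) d = cinner x (S d)" if "d \<in> B" for x d using B(3) that by auto
  moreover have "csubspace {y. cinner (T x) y = cinner x (S y)}" for x
    by (rule csubspaceI) (auto simp: lin bounded_clinear_zero bounded_clinear_add
        bounded_clinear_scaleC cinner_add_right cinner_scaleC_right)
  ultimately have "complex_vector.span B \<subseteq> {y. cinner (T x) y = cinner x (S y)}" for x
    by (intro complex_vector.span_minimal) auto
  then have "cinner (T x) y = cinner x (S y)" for x y using B(3) by blast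
  then show thesis using S that by blast
qed

end

theorem theorem2:
  fixes G :: "('g, 'b) monoid_scheme"
    and X :: "'g topology"
    and \<pi> :: "'g \<Rightarrow> 'h::chilbert_space \<Rightarrow> 'h"
    and A :: "('h \<Rightarrow> 'h) set"
  assumes "compact_group G X"
    and "unitary_rep G X \<pi>"
    and "irreducible_rep G \<pi>"
    and "inductive_algebra G \<pi> A"
  shows "self_adjoint A"
proof -
  interpret compact_group G X by fact
  interpret compact_irreducible_inductive_algebra G X \<pi> A by unfold_locales fact+
  show ?thesis
    unfolding self_adjoint_def by (metis adjoint_in_A cadjoint_eqI)
qed

end
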